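(* Let $G$ be a finite simple claw-free graph with minimum degree $\delta(G) \ge 2$. Then $$\gamma_g(G) \le \left\lceil \frac{11}{20} \, n(G) \right\rceil.$$ Moreover, if $G$ is also connected and it is neither a $5$-cycle nor a $9$-cycle, then $$\gamma_g(G) \le \left\lfloor \frac{11}{20} \, n(G) \right\rfloor.$$
   Context: All graphs are finite, simple and undirected (and non-empty); $n(G)$ is the number of vertices of $G$. Graphs need not be connected unless stated. A graph is claw-free if it has no induced subgraph isomorphic to the star $K_{1,3}$. The closed neighborhood of $v$ is $N_G[v]=N_G(v)\cup\{v\}$, and a vertex $v$ dominates exactly the vertices of $N_G[v]$. Domination game: two players, Dominator and Staller, alternately select vertices of $G$; a selected vertex must dominate at least one vertex not dominated by the previously selected vertices, i.e. selecting $v$ is legal if and only if $N_G[v]\not\subseteq \bigcup_{u\in D}N_G[u]$, where $D$ is the set of previously selected vertices. The game ends when no legal move exists (equivalently, when the selected vertices form a dominating set). Dominator wants to minimize the total number of moves, Staller wants to maximize it. The game domination number $\gamma_g(G)$ is the total number of moves (of both players) when Dominator moves first and both players play optimally. *)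

theory Defs
  imports Complex_Main "Graph_Theory.Graph_Theory"
begin

text \<open>
  A finite simple undirected graph is a \<open>graph\<close> in the sense of the AFP entry Graph_Theory: a
  finite, loop-free, symmetric digraph without parallel arcs. Each undirected edge is a pair of
  opposite arcs, so the degree of a vertex is its out-degree. The library allows the empty graph.
\<close>

definition min_degree :: "('a, 'b) pre_digraph \<Rightarrow> nat" where
  "min_degree G = Min (out_degree G ` verts G)"

definition claw_free :: "('a, 'b) pre_digraph \<Rightarrow> bool" where
  "claw_free G \<longleftrightarrow> \<not> (\<exists>H. induced_subgraph H G \<and> complete_bipartite_digraph 1 3 H)"

text \<open>For \<open>n \<ge> 3\<close>, this is the cycle on \<open>n\<close> vertices.\<close>

definition cycle_graph :: "nat \<Rightarrow> nat pair_pre_digraph" where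
  "cycle_graph n = \<lparr> pverts = {..<n},
     parcs = {(i, j). i < n \<and> j < n \<and> (j = (i + 1) mod n \<or> i = (j + 1) mod n)} \<rparr>"


definition closed_nbhd :: "('a, 'b) pre_digraph \<Rightarrow> 'a \<Rightarrow> 'a set" where
  "closed_nbhd G v = insert v {u. v \<rightarrow>\<^bsub>G\<^esub> u}"

definition legal_moves :: "('a, 'b) pre_digraph \<Rightarrow> 'a set \<Rightarrow> 'a set" where
  "legal_moves G D = {v \<in> verts G. \<not> closed_nbhd G v \<subseteq> (\<Union>u\<in>D. closed_nbhd G u)}"

datatype player = Dominator | Staller

text \<open>
  \<open>remaining_moves G p D\<close> is the number of further moves under optimal play when the vertices in
  \<open>D\<close> have been selected and it is the turn of \<open>p\<close>. The finiteness guard only serves to make the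
  function total; it is irrelevant for finite graphs.
\<close>

function remaining_moves :: "('a, 'b) pre_digraph \<Rightarrow> player \<Rightarrow> 'a set \<Rightarrow> nat" where
  "remaining_moves G Dominator D =
     (if finite (verts G) \<and> legal_moves G D \<noteq> {}
      then 1 + Min ((\<lambda>v. remaining_moves G Staller (insert v D)) ` legal_moves G D) else 0)"
| "remaining_moves G Staller D =
     (if finite (verts G) \<and> legal_moves G D \<noteq> {}
      then 1 + Max ((\<lambda>v. remaining_moves G Dominator (insert v D)) ` legal_moves G D) else 0)"
  by pat_completeness auto

lemma card_legal_moves_insert_less:
  assumes "finite (verts G)" "v \<in> legal_moves G D"
  shows "card (legal_moves G (insert v D)) < card (legal_moves G D)"
proof (rule psubset_card_mono)
  show "finite (legal_moves G D)"
    using assms(1) by (simp add: legal_moves_def)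
  have "legal_moves G (insert v D) \<subseteq> legal_moves G D" "v \<notin> legal_moves G (insert v D)"
    by (auto simp: legal_moves_def)
  with assms(2) show "legal_moves G (insert v D) \<subset> legal_moves G D"
    by blast
qed

termination remaining_moves
  by (relation "measure (\<lambda>(G, p, D). card (legal_moves G D))")
     (auto intro: card_legal_moves_insert_less)

declare remaining_moves.simps [simp del]

definition game_domination_number :: "('a, 'b) pre_digraph \<Rightarrow> nat" where
  "game_domination_number G = remaining_moves G Dominator {}"

end

theory Submission
  imports Defs
begin

text \<open>
  Weight every undominated vertex by 11 (by 20 if it has no undominated neighbour) and every dominated
  vertex with a non-isolated undominated neighbour by 4. Every move of Staller decreases the total
  weight by at least 10, and if Dominator can gain 30 in his move, then the round has paid its price
  of 40. Claw-freeness restricts the positions in which he cannot do this: the undominated vertices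
  then induce isolated vertices, cycles, and single edges in a triangle. Outside of cycles of length at
  least 5, the replies of Staller are then expensive enough. A cycle can cost Dominator a small deficit
  when he opens it, but his second move on it repairs this unless the cycle has length 5 or 9, and then
  an isolated vertex is left over as a tempo move for Dominator. Hence a single deficit of at most 5 remains,
  and it is at most 1, and compensated for by the first move, in a connected graph that is not a cycle.
\<close>

section \<open>Positions and their potential\<close>

text \<open>The obstacle is that a move may isolate undominated vertices, which raises the weight of
  each by 9. The weight 4 is there to absorb this: a newly isolated vertex has at least two
  neighbours, admissibility lets no two such vertices share one, and none of these neighbours is
  attached after the move. So 8 of the 9 are paid back. Hence a move that touches no isolated
  vertex, dominates k new vertices, isolates j vertices and strips m attached or newly dominated
  vertices of all undominated neighbours gains at least 7 k + 4 m - j. The other constants are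
  instances of this: 7 + 4 - 1 = 10 and 14 + 4 - 2 = 16 for replies of Staller that dominate one or
  two vertices, 21 + 4 = 25 for opening a cycle. An opening answered with 10 or 11 is thus short by
  5 or 4. A final deficit of 5 disappears in the rounding up, since it is less than the price 20 of
  a move.\<close>

locale claw_free_nbhd =
  fixes V :: "'a set" and N :: "'a \<Rightarrow> 'a set"
  assumes finite_V: "finite V"
    and N_sub: "N v \<subseteq> V"
    and N_sym: "u \<in> N v \<Longrightarrow> v \<in> N u"
    and N_irrefl: "v \<notin> N v"
    and deg2: "v \<in> V \<Longrightarrow> 2 \<le> card (N v)"
    and claw: "\<lbrakk>b \<in> N a; c \<in> N a; d \<in> N a; b \<noteq> c; b \<noteq> d; c \<noteq> d\<rbrakk>
      \<Longrightarrow> c \<in> N b \<or> d \<in> N b \<or> d \<in> N c"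
begin

definition Nc :: "'a \<Rightarrow> 'a set" where "Nc v = insert v (N v)"

text \<open>
  \<open>U\<close> is the set of undominated vertices. If a dominated vertex \<open>v\<close> has been dominated by its neighbour
  \<open>d\<close>, then no undominated neighbour of \<open>v\<close> is adjacent to \<open>d\<close>; claw-freeness makes these
  neighbours a clique. This is all that the proof needs to know about the set of selected vertices.
\<close>

definition admissible :: "'a set \<Rightarrow> bool" where
  "admissible U \<longleftrightarrow> U \<subseteq> V \<and> (\<forall>v\<in>V - U. \<forall>a\<in>N v \<inter> U. \<forall>b\<in>N v \<inter> U. a \<noteq> b \<longrightarrow> b \<in> N a)"

definition isolated :: "'a set \<Rightarrow> 'a set" where "isolated U = {x \<in> U. N x \<inter> U = {}}"

definition attached :: "'a set \<Rightarrow> 'a set" where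
  "attached U = {v \<in> V - U. \<exists>x \<in> N v \<inter> U. x \<notin> isolated U}"

text \<open>
  The initial potential is \<open>11 n\<close>, and a move is worth \<open>20\<close>. An isolated undominated vertex will cost
  exactly one move, whence its total weight \<open>20\<close>.
\<close>

definition potential :: "'a set \<Rightarrow> int" where
  "potential U = 11 * int (card U) + 9 * int (card (isolated U)) + 4 * int (card (attached U))"

text \<open>
  If Dominator is to move when \<open>U\<close> is undominated, then he can finish after \<open>m\<close> further moves (of both
  players) with \<open>20 m \<le> K\<close>.
\<close>

inductive dom_bound :: "'a set \<Rightarrow> int \<Rightarrow> bool" where
  dom_bound_empty: "0 \<le> K \<Longrightarrow> dom_bound {} K"
| dom_bound_move: "\<lbrakk>v \<in> V; Nc v \<inter> U \<noteq> {}; 20 \<le> K;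
    \<And>w. w \<in> V \<Longrightarrow> Nc w \<inter> (U - Nc v) \<noteq> {} \<Longrightarrow> dom_bound (U - Nc v - Nc w) (K - 40)\<rbrakk> \<Longrightarrow> dom_bound U K"

lemma dom_bound_mono: "dom_bound U K \<Longrightarrow> K \<le> K' \<Longrightarrow> dom_bound U K'"
proof (induction arbitrary: K' rule: dom_bound.induct)
  case (dom_bound_move v U K)
  show ?case
  proof (rule dom_bound.dom_bound_move[OF dom_bound_move.hyps(1,2)])
    show "20 \<le> K'" using dom_bound_move by linarith
    show "dom_bound (U - Nc v - Nc w) (K' - 40)" if "w \<in> V" "Nc w \<inter> (U - Nc v) \<noteq> {}" for w
      using dom_bound_move.IH[OF that, of "K' - 40"] dom_bound_move.prems by simp
  qed
qed (auto intro: dom_bound_empty)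

lemma admissibleD: "admissible U \<Longrightarrow> v \<in> V \<Longrightarrow> v \<notin> U \<Longrightarrow> a \<in> N v \<Longrightarrow> a \<in> U \<Longrightarrow> b \<in> N v \<Longrightarrow> b \<in> U \<Longrightarrow> a \<noteq> b \<Longrightarrow> b \<in> N a"
  unfolding admissible_def by blast

lemma admissible_subset: "admissible U \<Longrightarrow> U \<subseteq> V"
  unfolding admissible_def by blast

lemma admissible_finite: "admissible U \<Longrightarrow> finite U"
  using admissible_subset finite_V finite_subset by blast

lemma N_V: "u \<in> N v \<Longrightarrow> u \<in> V" "u \<in> N v \<Longrightarrow> v \<in> V"
  using N_sub N_sym by blast+

lemma finite_N [simp]: "finite (N v)"
  using N_sub finite_V finite_subset by blast

lemma finite_att [simp]: "finite (attached U)"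
  unfolding attached_def using finite_V by auto

lemma admissible_V: "admissible V"
  unfolding admissible_def by blast

text \<open>Only a newly dominated \<open>x\<close> is critical. If it still has undominated
  neighbours \<open>a\<close> and \<open>b\<close>, then \<open>x\<close> is not \<open>v\<close>,
  so \<open>v\<close>, \<open>a\<close>, \<open>b\<close> are three neighbours of \<open>x\<close>.
  Neither \<open>a\<close> nor \<open>b\<close> is adjacent to \<open>v\<close>, so claw-freeness
  joins them.\<close>

lemma admissible_move:
  assumes "admissible U"
  shows "admissible (U - Nc v)"
  unfolding admissible_def
proof (intro conjI ballI impI)
  show "U - Nc v \<subseteq> V" using admissible_subset[OF assms] by blast
  fix x a b assume x: "x \<in> V - (U - Nc v)" and a: "a \<in> N x \<inter> (U - Nc v)" and b: "b \<in> N x \<inter> (U - Nc v)"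
    and ne: "a \<noteq> b"
  show "b \<in> N a"
  proof (cases "x \<in> U")
    case False
    then show ?thesis using admissibleD[OF assms, of x a b] x a b ne by blast
  next
    case True
    then have "x \<in> Nc v" using x by blast
    then have "x \<in> N v" using a unfolding Nc_def by blast
    then have "v \<in> N x" using N_sym by blast
    then have "a \<in> N v \<or> b \<in> N v \<or> b \<in> N a"
      using claw[of v x a b] a b ne unfolding Nc_def by blast
    then show ?thesis using a b unfolding Nc_def by blast
  qed
qed

section \<open>The gain of a single move\<close>

text \<open>These facts allow a newly isolated vertex to be charged to its neighbours. It had an
  undominated neighbour before the move, so all its dominated neighbours were attached. After the
  move its neighbours are all dominated; each sees a clique of undominated vertices that contains
  the isolated vertex \<open>z\<close>, hence sees \<open>z\<close> alone.\<close>

lemma newly_isolated: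
  assumes "admissible U" "v \<in> V" and z: "z \<in> isolated (U - Nc v) - isolated U"
  shows "z \<in> U - Nc v" "N z \<inter> (U - Nc v) = {}" "N z \<inter> (Nc v \<inter> U) \<noteq> {}"
    "N z \<subseteq> (Nc v \<inter> U) \<union> attached U"
    "t \<in> N z \<Longrightarrow> N t \<inter> (U - Nc v) = {z}" "t \<in> N z \<Longrightarrow> t \<notin> attached (U - Nc v)"
proof -
  show 1: "z \<in> U - Nc v" and 2: "N z \<inter> (U - Nc v) = {}" using z unfolding isolated_def by auto
  show 3: "N z \<inter> (Nc v \<inter> U) \<noteq> {}" using z unfolding isolated_def by auto
  show "N z \<subseteq> (Nc v \<inter> U) \<union> attached U"
  proof
    fix t assume t: "t \<in> N z"
    show "t \<in> (Nc v \<inter> U) \<union> attached U"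
    proof (cases "t \<in> U")
      case True then show ?thesis using 2 t by blast
    next
      case False
      then show ?thesis using t 1 z N_sym[OF t] N_V[OF t] unfolding attached_def by blast
    qed
  qed
  show 5: "N t \<inter> (U - Nc v) = {z}" if "t \<in> N z" for t
  proof -
    have "t \<notin> U - Nc v" using that 2 by blast
    moreover have "z \<in> N t" "t \<in> V" using that N_sym N_V by blast+
    ultimately have "\<And>b. b \<in> N t \<Longrightarrow> b \<in> U - Nc v \<Longrightarrow> b = z"
      using admissibleD[OF admissible_move[OF assms(1), of v], of t z] 1 2 by blast
    then show ?thesis using \<open>z \<in> N t\<close> 1 by blast
  qed
  show "t \<notin> attached (U - Nc v)" if "t \<in> N z" for t
  proof
    assume "t \<in> attached (U - Nc v)"
    then obtain s where "s \<in> N t \<inter> (U - Nc v)" "s \<notin> isolated (U - Nc v)" unfolding attached_def by blast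
    then show False using 5[OF that] z by auto
  qed
qed

text \<open>The new attached set, \<open>X\<close>, and the neighbours of newly isolated vertices
  are disjoint parts of the newly dominated and the old attached vertices. Counting them gives -11 +
  4 = -7 for a newly dominated vertex, -4 for an element of \<open>X\<close>, and at most 9 - 2 * 4
  = 1 for a newly isolated vertex. The third claim is the same count without the new attached set.
  For the second, every newly isolated vertex is the only undominated neighbour of some newly
  dominated vertex outside \<open>X\<close>.\<close>

lemma move_gain:
  assumes ok: "admissible U" and v: "v \<in> V" and ni: "Nc v \<inter> isolated U = {}"
    and X: "X \<subseteq> (Nc v \<inter> U) \<union> attached U" "\<And>t. t \<in> X \<Longrightarrow> N t \<inter> (U - Nc v) = {}"
  shows "potential (U - Nc v) + 7 * int (card (Nc v \<inter> U)) + 4 * int (card X)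
           \<le> potential U + int (card (isolated (U - Nc v) - isolated U))"
    and "card (isolated (U - Nc v) - isolated U) + card (Nc v \<inter> U \<inter> X) \<le> card (Nc v \<inter> U)"
    and "2 * card (isolated (U - Nc v) - isolated U) + card X \<le> card (Nc v \<inter> U) + card (attached U)"
proof -
  define A where "A = Nc v \<inter> U"
  define U' where "U' = U - Nc v"
  define Z where "Z = isolated U' - isolated U"
  note nz = newly_isolated[OF ok v, folded A_def U'_def, folded Z_def]
  have fU: "finite U" using ok admissible_finite by blast
  have fA: "finite A" and fU': "finite U'" unfolding A_def U'_def using fU by auto
  have fI: "finite (isolated U)" "finite (isolated U')" unfolding isolated_def using fU fU' by auto
  have fZ: "finite Z" unfolding Z_def using fI by auto
  have fX: "finite X" using X(1) fA unfolding A_def by (meson finite_UnI finite_att finite_subset)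
  have cU: "card U = card U' + card A"
  proof -
    have "U = U' \<union> A" "U' \<inter> A = {}" unfolding U'_def A_def by auto
    then show ?thesis using card_Un_disjoint[OF fU' fA] by simp
  qed
  have isub: "isolated U \<subseteq> isolated U'" using ni unfolding isolated_def U'_def by blast
  have cI: "card (isolated U') = card (isolated U) + card Z"
  proof -
    have "isolated U' = isolated U \<union> Z" "isolated U \<inter> Z = {}" unfolding Z_def using isub by auto
    then show ?thesis using card_Un_disjoint[OF fI(1) fZ] by simp
  qed
  define Y where "Y = (\<Union>z\<in>Z. N z)"
  have fY: "finite Y" unfolding Y_def using fZ by auto
  have cY: "2 * card Z \<le> card Y"
  proof -
    have "N a \<inter> N b = {}" if "a \<in> Z" "b \<in> Z" "a \<noteq> b" for a b
    proof (rule ccontr)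
      assume "\<not> ?thesis"
      then obtain t where "t \<in> N a" "t \<in> N b" by blast
      then show False using nz(5)[OF that(1)] nz(5)[OF that(2)] that(3) by fastforce
    qed
    then have "card Y = (\<Sum>z\<in>Z. card (N z))" unfolding Y_def
      by (intro card_UN_disjoint fZ) auto
    moreover have "\<And>z. z \<in> Z \<Longrightarrow> 2 \<le> card (N z)"
      using deg2 nz(1) admissible_subset[OF ok] unfolding U'_def by blast
    then have "(\<Sum>z\<in>Z. 2) \<le> (\<Sum>z\<in>Z. card (N z))" by (intro sum_mono) auto
    ultimately show ?thesis by simp
  qed
  have d1: "X \<inter> Y = {}"
  proof -
    have "t \<notin> X" if "t \<in> Y" for t
    proof -
      obtain z where "z \<in> Z" "t \<in> N z" using \<open>t \<in> Y\<close> unfolding Y_def by blast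
      then have "N t \<inter> U' = {z}" using nz(5) by blast
      then show ?thesis using X(2)[of t] unfolding U'_def by auto
    qed
    then show ?thesis by blast
  qed
  have sub: "attached U' \<union> (X \<union> Y) \<subseteq> A \<union> attached U"
  proof -
    have "attached U' \<subseteq> A \<union> attached U"
    proof
      fix t assume "t \<in> attached U'"
      then obtain s where s: "t \<in> V" "t \<notin> U'" "s \<in> N t" "s \<in> U'" "s \<notin> isolated U'" unfolding attached_def by blast
      then have "s \<notin> isolated U" using isub by blast
      then show "t \<in> A \<union> attached U" using s unfolding attached_def A_def U'_def by blast
    qed
    moreover have "Y \<subseteq> A \<union> attached U" unfolding Y_def using nz(4) by blast
    ultimately show ?thesis using X(1) A_def by blast
  qed
  have d2: "attached U' \<inter> (X \<union> Y) = {}"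
  proof -
    have "t \<notin> attached U'" if "t \<in> X" for t using X(2)[OF that] unfolding attached_def U'_def by blast
    moreover have "t \<notin> attached U'" if "t \<in> Y" for t using that nz(6) unfolding Y_def by blast
    ultimately show ?thesis by blast
  qed
  have fAB: "finite (A \<union> attached U)" using fA by auto
  have "card (attached U' \<union> (X \<union> Y)) = card (attached U') + (card X + card Y)"
    using card_Un_disjoint[OF finite_att _ d2] card_Un_disjoint[OF fX fY d1] fX fY by simp
  moreover have "card (attached U' \<union> (X \<union> Y)) \<le> card (A \<union> attached U)" using card_mono[OF fAB sub] .
  moreover have "card (A \<union> attached U) \<le> card A + card (attached U)" by (rule card_Un_le)
  ultimately have cB: "card (attached U') + card X + 2 * card Z \<le> card A + card (attached U)" using cY by linarith
  show "potential (U - Nc v) + 7 * int (card (Nc v \<inter> U)) + 4 * int (card X)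
           \<le> potential U + int (card (isolated (U - Nc v) - isolated U))"
    unfolding A_def[symmetric] U'_def[symmetric] Z_def[symmetric] potential_def using cU cI cB by linarith
  show "2 * card (isolated (U - Nc v) - isolated U) + card X \<le> card (Nc v \<inter> U) + card (attached U)"
    unfolding A_def[symmetric] U'_def[symmetric] Z_def[symmetric] using cB by linarith
  \<comment> \<open>A newly dominated vertex is mapped to the one undominated neighbour it has left.
    Where there is no such unique neighbour, \<open>the_elem\<close> is arbitrary; this is harmless,
    as only \<open>Z\<close> has to be covered.\<close>
  have "Z \<subseteq> (\<lambda>a. the_elem (N a \<inter> U')) ` (A - X)"
  proof
    fix z assume z: "z \<in> Z"
    obtain a where a: "a \<in> N z" "a \<in> A" using nz(3)[OF z] by blast
    have e: "N a \<inter> U' = {z}" using nz(5)[OF z a(1)] .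
    have "a \<notin> X" using X(2)[of a] e unfolding U'_def by auto
    then show "z \<in> (\<lambda>a. the_elem (N a \<inter> U')) ` (A - X)" using a e by (auto simp: image_iff intro!: bexI[of _ a])
  qed
  then have "card Z \<le> card (A - X)" using fA surj_card_le[of "A - X" Z] by blast
  moreover have "card (A - X) + card (A \<inter> X) = card A"
    using card_Diff_subset_Int[of A X] card_mono[of A "A \<inter> X"] fA by auto
  ultimately show "card (isolated (U - Nc v) - isolated U) + card (Nc v \<inter> U \<inter> X) \<le> card (Nc v \<inter> U)"
    unfolding A_def[symmetric] U'_def[symmetric] Z_def[symmetric] by linarith
qed

text \<open>If \<open>v\<close> is not \<open>i\<close>, then \<open>v\<close> is dominated, and by
  admissibility it sees no undominated vertex besides the isolated \<open>i\<close>. Isolated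
  vertices attach nothing, so exactly 11 + 9 is gained.\<close>

lemma isolated_move:
  assumes ok: "admissible U" and v: "v \<in> V" and i: "i \<in> Nc v" "i \<in> isolated U"
  shows "Nc v \<inter> U = {i}" "U - Nc v = U - {i}" "isolated (U - {i}) = isolated U - {i}" "attached (U - {i}) = attached U"
    "potential U = potential (U - {i}) + 20"
proof -
  have iU: "i \<in> U" and iN: "N i \<inter> U = {}" using i unfolding isolated_def by auto
  show 1: "Nc v \<inter> U = {i}"
  proof (cases "v = i")
    case True then show ?thesis using iU iN unfolding Nc_def by blast
  next
    case False
    then have iv: "i \<in> N v" using i unfolding Nc_def by blast
    then have "v \<notin> U" using iN N_sym by blast
    then show ?thesis using admissibleD[OF ok v, of i] iv iU iN unfolding Nc_def by blast
  qed
  then show "U - Nc v = U - {i}" by blast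
  have adj: "N x \<inter> (U - {i}) = N x \<inter> U" if "x \<in> U" for x using that iN N_sym by blast
  show 2: "isolated (U - {i}) = isolated U - {i}" unfolding isolated_def using adj by auto
  show 3: "attached (U - {i}) = attached U"
  proof -
    have "x \<in> N i \<Longrightarrow> x \<notin> U" for x using iN by blast
    then show ?thesis using iU i(2) unfolding attached_def 2 by auto
  qed
  have fU: "finite U" using ok admissible_finite by blast
  then have "card U = Suc (card (U - {i}))" "card (isolated U) = Suc (card (isolated U - {i}))"
    using iU i(2) card.remove[of U i] card.remove[of "isolated U" i] finite_subset[of "isolated U" U]
    by (auto simp: isolated_def)
  then show "potential U = potential (U - {i}) + 20" unfolding potential_def 2 3 by simp
qed

lemma not_isolated_move:
  assumes "admissible U" "v \<in> V" "Nc v \<inter> U \<noteq> {}" "Nc v \<inter> isolated U = {}"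
  shows "v \<in> Nc v \<inter> U \<union> attached U"
proof (cases "v \<in> U")
  case True then show ?thesis unfolding Nc_def by blast
next
  case False then show ?thesis using assms(2,3,4) unfolding attached_def Nc_def by blast
qed

lemma Nc_gone: "N v \<inter> (U - Nc v) = {}"
  unfolding Nc_def by blast

text \<open>
  Only these moves of Staller can decrease the potential by less than \<open>16\<close>.
\<close>

definition lone :: "'a set \<Rightarrow> 'a \<Rightarrow> bool" where
  "lone U v \<longleftrightarrow> v \<notin> U \<and> (\<exists>a. N v \<inter> U = {a} \<and> a \<notin> isolated U)"

text \<open>With \<open>X = {v}\<close> in \<open>move_gain\<close>, a move that dominates k new
  vertices gains at least 7 k + 4 - k, which is 10 for k = 1 and 16 for k = 2. If k = 1 and the new
  vertex was not isolated, the move is \<open>lone\<close>.\<close>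

lemma staller_gain:
  assumes ok: "admissible U" and v: "v \<in> V" and leg: "Nc v \<inter> U \<noteq> {}"
  shows "potential (U - Nc v) + 10 \<le> potential U" "\<not> lone U v \<Longrightarrow> potential (U - Nc v) + 16 \<le> potential U"
proof -
  have "potential (U - Nc v) + 10 \<le> potential U \<and> (\<not> lone U v \<longrightarrow> potential (U - Nc v) + 16 \<le> potential U)"
  proof (cases "Nc v \<inter> isolated U = {}")
    case False
    then obtain i where i: "i \<in> Nc v" "i \<in> isolated U" by blast
    then show ?thesis using isolated_move[OF ok v i] by simp
  next
    case ni: True
    have vX: "{v} \<subseteq> Nc v \<inter> U \<union> attached U" using not_isolated_move[OF ok v leg ni] by blast
    note g = move_gain[OF ok v ni vX]
    have g1: "potential (U - Nc v) + 7 * int (card (Nc v \<inter> U)) + 4 \<le> potential U + int (card (isolated (U - Nc v) - isolated U))"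
      and g2: "card (isolated (U - Nc v) - isolated U) + card (Nc v \<inter> U \<inter> {v}) \<le> card (Nc v \<inter> U)"
      using g(1,2) Nc_gone by simp_all
    have f: "finite (Nc v \<inter> U)" using admissible_finite[OF ok] by blast
    then have c1: "card (Nc v \<inter> U) \<ge> 1" using leg by (simp add: Suc_leI card_gt_0_iff)
    have "potential (U - Nc v) + 16 \<le> potential U" if nl: "\<not> lone U v"
    proof -
      have "card (Nc v \<inter> U) \<ge> 2"
      proof (rule ccontr)
        assume "\<not> ?thesis"
        then have "card (Nc v \<inter> U) = 1" using c1 by linarith
        then obtain a where a: "Nc v \<inter> U = {a}" using card_1_singletonE by blast
        have "a \<notin> isolated U" using a ni by blast
        show False
        proof (cases "v \<in> U")
          case True
          then have "v \<in> Nc v \<inter> U" "N v \<inter> U \<subseteq> Nc v \<inter> U" unfolding Nc_def by auto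
          then have "a = v" "N v \<inter> U = {}" using a N_irrefl[of v] by auto
          then have "a \<in> isolated U" using True unfolding isolated_def by blast
          then show False using \<open>a \<notin> isolated U\<close> by blast
        next
          case False
          then have "Nc v \<inter> U = N v \<inter> U" unfolding Nc_def by auto
          then have "N v \<inter> U = {a}" using a by simp
          then show False using nl False \<open>a \<notin> isolated U\<close> unfolding lone_def by blast
        qed
      qed
      then show ?thesis using g1 g2 by linarith
    qed
    then show ?thesis using g1 g2 c1 by linarith
  qed
  then show "potential (U - Nc v) + 10 \<le> potential U" "\<not> lone U v \<Longrightarrow> potential (U - Nc v) + 16 \<le> potential U" by auto
qed


section \<open>Rounds, and the deficit carried through the induction\<close>

lemma potential_nonneg: "0 \<le> potential U"
  unfolding potential_def by simp

lemma card_move_less: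
  assumes "admissible U" "Nc v \<inter> U \<noteq> {}"
  shows "card (U - Nc v) < card U" "card (U - Nc v - Nc w) < card U"
proof -
  have "U - Nc v \<subset> U" using assms(2) by blast
  then show "card (U - Nc v) < card U" using admissible_finite[OF assms(1)] by (rule psubset_card_mono[rotated])
  have "U - Nc v - Nc w \<subset> U" using assms(2) by blast
  then show "card (U - Nc v - Nc w) < card U" using admissible_finite[OF assms(1)] by (rule psubset_card_mono[rotated])
qed

text \<open>The induction hypothesis of \<open>position_bound\<close> with deficit \<open>E\<close>,
  named so that each kind of round can be treated in a lemma of its own.\<close>

definition bounded_below :: "int \<Rightarrow> nat \<Rightarrow> bool" where
  "bounded_below E n \<longleftrightarrow> 0 \<le> E \<and> (\<forall>U. card U < n \<longrightarrow> admissible U \<longrightarrow> dom_bound U (potential U + E))"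

lemma bounded_belowD: "bounded_below E n \<Longrightarrow> card U < n \<Longrightarrow> admissible U \<Longrightarrow> potential U + E \<le> K \<Longrightarrow> dom_bound U K"
  unfolding bounded_below_def using dom_bound_mono by blast

lemma bounded_below_mono: "bounded_below E n \<Longrightarrow> m \<le> n \<Longrightarrow> bounded_below E m"
  unfolding bounded_below_def by simp

text \<open>Here 30 + 10 = 40 pays for the round. The bound \<open>K\<close> is kept apart from
  \<open>potential U\<close> so that surplus or debt of earlier moves can be carried along.\<close>

lemma round_any:
  assumes ok: "admissible U" and v: "v \<in> V" "Nc v \<inter> U \<noteq> {}" and IH: "bounded_below E (card U)"
    and K: "potential (U - Nc v) + E + 30 \<le> K"
  shows "dom_bound U K"
proof (rule dom_bound_move[OF v])
  show "20 \<le> K" using K IH potential_nonneg[of "U - Nc v"] unfolding bounded_below_def by linarith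
  show "dom_bound (U - Nc v - Nc w) (K - 40)" if w: "w \<in> V" "Nc w \<inter> (U - Nc v) \<noteq> {}" for w
    using bounded_belowD[OF IH card_move_less(2)[OF ok v(2)] admissible_move[OF admissible_move[OF ok]]]
      staller_gain(1)[OF admissible_move[OF ok] w] K by force
qed

definition quiet :: "'a set \<Rightarrow> bool" where "quiet U \<longleftrightarrow> (\<forall>w\<in>V. \<not> lone U w)"

text \<open>Without lone replies Staller gives up at least 16, so 24 is enough for
  Dominator.\<close>

lemma round_quiet:
  assumes ok: "admissible U" and v: "v \<in> V" "Nc v \<inter> U \<noteq> {}" and IH: "bounded_below E (card U)"
    and q: "quiet (U - Nc v)" and K: "potential (U - Nc v) + E + 24 \<le> K"
  shows "dom_bound U K"
proof (rule dom_bound_move[OF v])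
  show "20 \<le> K" using K IH potential_nonneg[of "U - Nc v"] unfolding bounded_below_def by linarith
  show "dom_bound (U - Nc v - Nc w) (K - 40)" if w: "w \<in> V" "Nc w \<inter> (U - Nc v) \<noteq> {}" for w
    using bounded_belowD[OF IH card_move_less(2)[OF ok v(2)] admissible_move[OF admissible_move[OF ok]]]
      staller_gain(2)[OF admissible_move[OF ok] w] q w(1) K unfolding quiet_def by force
qed

section \<open>Moves of Dominator with a large gain\<close>

lemma not_isolated_Nc: "x \<in> U \<Longrightarrow> N x \<inter> U \<noteq> {} \<Longrightarrow> Nc x \<inter> isolated U = {}"
  unfolding Nc_def isolated_def using N_sym by blast

lemma card_Nc:
  assumes "admissible U" "x \<in> U"
  shows "card (Nc x \<inter> U) = Suc (card (N x \<inter> U))"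
proof -
  have "Nc x \<inter> U = insert x (N x \<inter> U)" "x \<notin> N x \<inter> U" using assms(2) N_irrefl unfolding Nc_def by auto
  then show ?thesis by simp
qed

text \<open>Playing \<open>x\<close> gains enough unless it has exactly three undominated neighbours
  and isolates three vertices, one behind each neighbour. Then claw-freeness makes two of these
  neighbours adjacent, and one of them, \<open>y\<close>, has degree at least 3 itself and a pendant
  vertex \<open>z\<close>. Playing \<open>y\<close> strips both \<open>y\<close> and
  \<open>z\<close>, which gains at least 34.\<close>

lemma gain_degree_ge_3:
  assumes ok: "admissible U" and x: "x \<in> U" "3 \<le> card (N x \<inter> U)"
  shows "\<exists>v\<in>V. Nc v \<inter> U \<noteq> {} \<and> potential (U - Nc v) + 30 \<le> potential U"
proof -
  have xV: "x \<in> V" using x admissible_subset ok by blast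
  have leg: "Nc x \<inter> U \<noteq> {}" using x unfolding Nc_def by blast
  have ni: "Nc x \<inter> isolated U = {}" using not_isolated_Nc[OF x(1)] x(2) by force
  define Z where "Z = isolated (U - Nc x) - isolated U"
  note nz = newly_isolated[OF ok xV, folded Z_def]
  have X: "{x} \<subseteq> Nc x \<inter> U \<union> attached U" using x unfolding Nc_def by blast
  have g: "potential (U - Nc x) + 7 * int (card (Nc x \<inter> U)) + 4 \<le> potential U + int (card Z)"
    "card Z + card (Nc x \<inter> U \<inter> {x}) \<le> card (Nc x \<inter> U)"
    using move_gain(1,2)[OF ok xV ni X] Nc_gone[of x U] unfolding Z_def by auto
  have e: "Nc x \<inter> U \<inter> {x} = {x}" using x unfolding Nc_def by blast
  show ?thesis
  proof (cases "card (N x \<inter> U) = 3 \<and> card Z = 3")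
    case False
    then have "potential (U - Nc x) + 30 \<le> potential U" using g x(2) card_Nc[OF ok x(1)] unfolding e by auto
    then show ?thesis using xV leg by blast
  next
    case True
    have "\<forall>z\<in>Z. \<exists>y. y \<in> N z \<inter> (Nc x \<inter> U)" using nz(3) by blast
    then obtain f where f: "\<And>z. z \<in> Z \<Longrightarrow> f z \<in> N z \<inter> (Nc x \<inter> U)" by metis
    have fx: "f z \<in> N x \<inter> U" if z: "z \<in> Z" for z
    proof -
      have "f z \<noteq> x"
      proof
        assume "f z = x"
        then have "z \<in> N x" using f[OF z] N_sym by blast
        then show False using nz(1)[OF z] unfolding Nc_def by blast
      qed
      then show ?thesis using f[OF z] unfolding Nc_def by blast
    qed
    have f1: "N (f z) \<inter> (U - Nc x) = {z}" if "z \<in> Z" for z using nz(5)[OF that] f[OF that] by blast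
    have inj: "inj_on f Z" by (rule inj_onI) (metis f1 singleton_inject)
    have "f ` Z \<subseteq> N x \<inter> U" using fx by blast
    moreover have "card (f ` Z) = card (N x \<inter> U)" using card_image[OF inj] True by simp
    ultimately have im: "f ` Z = N x \<inter> U" by (intro card_subset_eq) auto
    obtain a b c where abc: "Z = {a, b, c}" "a \<noteq> b" "a \<noteq> c" "b \<noteq> c" using True card_3_iff[of Z] by blast
    have ne: "f a \<noteq> f b" "f a \<noteq> f c" "f b \<noteq> f c" using inj abc unfolding inj_on_def by auto
    have "f b \<in> N (f a) \<or> f c \<in> N (f a) \<or> f c \<in> N (f b)"
      using claw[of "f a" x "f b" "f c"] fx abc(1) ne by blast
    then obtain z z' where z: "z \<in> Z" "z' \<in> Z" "z \<noteq> z'" "f z' \<in> N (f z)"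
      using abc by blast
    define y where "y = f z"
    have yU: "y \<in> U" and yx: "y \<in> N x" and yV: "y \<in> V" using fx[OF z(1)] N_V unfolding y_def by blast+
    have zy: "z \<in> N y" "z \<in> U" "z \<notin> Nc x" using f1[OF z(1)] unfolding y_def by blast+
    have y': "f z' \<in> N y" "f z' \<in> U" "f z' \<in> N x" using z fx unfolding y_def by blast+
    \<comment> \<open>Any undominated neighbour of \<open>z\<close> was dominated by
      \<open>x\<close>, so it is \<open>f w\<close> for some \<open>w\<close>; but outside
      \<open>Nc x\<close> the vertex \<open>f w\<close> sees only \<open>w\<close>.\<close>
    have Nz: "N z \<inter> U \<subseteq> {y}"
    proof
      fix t assume t: "t \<in> N z \<inter> U"
      then have "t \<in> Nc x" using nz(2)[OF z(1)] by blast
      moreover have "t \<noteq> x" using t zy(3) N_sym unfolding Nc_def by blast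
      ultimately have "t \<in> f ` Z" using t unfolding im Nc_def by blast
      then obtain w where w: "w \<in> Z" "t = f w" by blast
      have "z \<in> N t \<inter> (U - Nc x)" using t N_sym zy by blast
      then have "w = z" using f1[OF w(1)] w(2) by auto
      then show "t \<in> {y}" using w y_def by blast
    qed
    have sub: "{x, f z', z} \<subseteq> N y \<inter> U" using zy y' x yx N_sym by blast
    have "card {x, f z', z} = 3"
    proof -
      have "x \<noteq> f z'" "x \<noteq> z" "f z' \<noteq> z" using y'(3) zy(3) N_irrefl unfolding Nc_def by auto
      then show ?thesis by simp
    qed
    then have d: "3 \<le> card (N y \<inter> U)" using card_mono[OF _ sub] by simp
    have niy: "Nc y \<inter> isolated U = {}" using not_isolated_Nc[OF yU] zy by blast
    have Xy: "{y, z} \<subseteq> Nc y \<inter> U \<union> attached U" using yU zy unfolding Nc_def by blast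
    have Xy': "N t \<inter> (U - Nc y) = {}" if "t \<in> {y, z}" for t
      using that Nc_gone[of y U] Nz unfolding Nc_def by auto
    have "Nc y \<inter> U \<inter> {y, z} = {y, z}" using yU zy unfolding Nc_def by blast
    moreover have "y \<noteq> z" using zy N_irrefl by blast
    ultimately have "potential (U - Nc y) + 30 \<le> potential U"
      using move_gain(1,2)[OF ok yV niy Xy Xy'] d card_Nc[OF ok yU] by auto
    then show ?thesis using yV yU unfolding Nc_def by blast
  qed
qed

text \<open>
  The gain of 31 in the first move compensates for the deficit 1 that is possible later.
\<close>

lemma gain_fresh:
  assumes x: "x \<in> V" "3 \<le> card (N x)"
  shows "potential (V - Nc x) + 31 \<le> potential V"
proof -
  have Nx: "N x \<inter> V = N x" using N_sub by blast
  have ni: "Nc x \<inter> isolated V = {}" using not_isolated_Nc[OF x(1)] x(2) Nx by force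
  have X: "{x} \<subseteq> Nc x \<inter> V \<union> attached V" using x unfolding Nc_def by blast
  have "attached V = {}" unfolding attached_def by blast
  moreover have "Nc x \<inter> V \<inter> {x} = {x}" using x unfolding Nc_def by blast
  ultimately show ?thesis
    using move_gain[OF admissible_V x(1) ni X] Nc_gone[of x V] x(2) card_Nc[OF admissible_V x(1)] unfolding Nx by auto
qed

text \<open>The degree condition supplies a second neighbour of \<open>x\<close>, which is already
  dominated and therefore sees a clique containing \<open>x\<close>.\<close>

lemma attached_leaf:
  assumes ok: "admissible U" and x: "x \<in> U" "N x \<inter> U = {y}"
  shows "\<exists>b. b \<in> attached U \<and> b \<in> N x \<and> N b \<inter> U \<subseteq> {x, y}"
proof -
  have "2 \<le> card (N x)" using deg2 x admissible_subset[OF ok] by blast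
  then have "\<not> N x \<subseteq> {y}" using card_mono[of "{y}" "N x"] by auto
  then obtain b where b: "b \<in> N x" "b \<noteq> y" by blast
  then have "b \<notin> U" using x by blast
  moreover have "b \<in> V" "x \<in> N b" using b N_V N_sym by blast+
  moreover have "x \<notin> isolated U" using x unfolding isolated_def by blast
  ultimately have "b \<in> attached U" using x unfolding attached_def by blast
  moreover have "N b \<inter> U \<subseteq> {x, y}"
    using admissibleD[OF ok \<open>b \<in> V\<close> \<open>b \<notin> U\<close> \<open>x \<in> N b\<close> x(1)] x(2) by blast
  ultimately show ?thesis using b by blast
qed

text \<open>Playing \<open>y\<close> strips \<open>y\<close>, the leaf \<open>x\<close> and the
  vertex of \<open>attached_leaf\<close>; already for degree 2 this gives 21 + 12 - 1 = 32.\<close>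

lemma gain_leaf:
  assumes ok: "admissible U" and x: "x \<in> U" "N x \<inter> U = {y}" and y: "2 \<le> card (N y \<inter> U)"
  shows "potential (U - Nc y) + 30 \<le> potential U"
proof -
  have yU: "y \<in> U" "y \<in> V" and xy: "x \<in> N y" "x \<noteq> y" using x N_sym N_V N_irrefl by blast+
  obtain b where b: "b \<in> attached U" "b \<in> N x" "N b \<inter> U \<subseteq> {x, y}" using attached_leaf[OF ok x] by blast
  have bU: "b \<notin> U" using b unfolding attached_def by blast
  have ni: "Nc y \<inter> isolated U = {}" using not_isolated_Nc[OF yU(1)] xy x by blast
  have X: "{x, y, b} \<subseteq> Nc y \<inter> U \<union> attached U" using b yU x xy unfolding Nc_def by blast
  have X': "N t \<inter> (U - Nc y) = {}" if "t \<in> {x, y, b}" for t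
    using that b x xy Nc_gone[of y U] unfolding Nc_def by auto
  have "Nc y \<inter> U \<inter> {x, y, b} = {x, y}" using bU x(1) yU(1) xy unfolding Nc_def by auto
  moreover have "b \<noteq> x" "b \<noteq> y" using bU x(1) yU(1) by auto
  then have "card {x, y, b} = 3" using xy by simp
  ultimately show ?thesis
    using move_gain(1,2)[OF ok yU(2) ni X X'] y card_Nc[OF ok yU(1)] xy by auto
qed

text \<open>The degree bounds make the triangle a component, so nothing is isolated: 21 + 12 =
  33.\<close>

lemma gain_triangle:
  assumes ok: "admissible U" and x: "x \<in> U" "N x \<inter> U = {y, u}" "u \<in> N y"
    and d: "card (N y \<inter> U) \<le> 2" "card (N u \<inter> U) \<le> 2"
  shows "potential (U - Nc x) + 30 \<le> potential U"
proof -
  have yu: "y \<in> U" "u \<in> U" "y \<noteq> u" "x \<noteq> y" "x \<noteq> u" "x \<in> V" "x \<in> N y" "x \<in> N u" "y \<in> N u"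
    using x N_irrefl N_V N_sym by blast+
  have "{x, u} = N y \<inter> U" using x yu d by (intro card_seteq) auto
  moreover have "{x, y} = N u \<inter> U" using x yu d by (intro card_seteq) auto
  ultimately have nn: "N y \<inter> U = {x, u}" "N u \<inter> U = {x, y}" by auto
  have ni: "Nc x \<inter> isolated U = {}" using not_isolated_Nc[OF x(1)] x by blast
  have A: "Nc x \<inter> U = {x, y, u}" using x unfolding Nc_def by blast
  have X: "{x, y, u} \<subseteq> Nc x \<inter> U \<union> attached U" using A by blast
  have X': "N t \<inter> (U - Nc x) = {}" if "t \<in> {x, y, u}" for t
    using that nn x unfolding Nc_def by auto
  show ?thesis
    using move_gain(1,2)[OF ok yu(6) ni X X'] yu unfolding A by auto
qed

text \<open>The edge is a component, so nothing is isolated: 14 + 8, and 4 for each stripped vertex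
  of \<open>B\<close>. One such vertex gives 26, two give 30.\<close>

lemma gain_pair:
  assumes ok: "admissible U" and x: "x \<in> U" "N x \<inter> U = {y}" "N y \<inter> U = {x}"
    and B: "B \<subseteq> attached U" "\<And>b. b \<in> B \<Longrightarrow> N b \<inter> U \<subseteq> {x, y}"
  shows "potential (U - Nc x) + 22 + 4 * int (card B) \<le> potential U" "Nc x \<inter> U = {x, y}"
proof -
  have y: "y \<in> U" "x \<noteq> y" "x \<in> V" using x N_irrefl N_V by blast+
  have ni: "Nc x \<inter> isolated U = {}" using not_isolated_Nc[OF x(1)] x by blast
  show A: "Nc x \<inter> U = {x, y}" using x unfolding Nc_def by blast
  have X: "{x, y} \<union> B \<subseteq> Nc x \<inter> U \<union> attached U" using A B by blast
  have X': "N t \<inter> (U - Nc x) = {}" if t: "t \<in> {x, y} \<union> B" for t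
  proof -
    have "N t \<inter> U \<subseteq> Nc x"
    proof (cases "t \<in> B")
      case True then show ?thesis using B(2)[OF True] A by blast
    next
      case False then have "t = x \<or> t = y" using t by blast
      then show ?thesis using x A by blast
    qed
    then show ?thesis by blast
  qed
  have "{x, y} \<inter> B = {}" using B x y unfolding attached_def by blast
  moreover have "finite B" using B finite_att finite_subset by blast
  ultimately have "card ({x, y} \<union> B) = 2 + card B" using card_Un_disjoint[of "{x, y}" B] y by simp
  moreover have "{x, y} \<inter> ({x, y} \<union> B) = {x, y}" by blast
  ultimately show "potential (U - Nc x) + 22 + 4 * int (card B) \<le> potential U"
    using move_gain(1,2)[OF ok y(3) ni X X'] y unfolding A by auto
qed

text \<open>\<open>C\<close> is a union of components of the graph induced by \<open>U\<close>. A
  dominated vertex sees a clique, so it cannot see both \<open>C\<close> and the rest. Hence nothing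
  changes away from \<open>C\<close>, and \<open>T\<close> survives as isolated vertices. This
  describes the position after a component has been used up.\<close>

lemma closed_del:
  assumes ok: "admissible U" and C: "C \<subseteq> U" "\<forall>x\<in>C. N x \<inter> U \<subseteq> C"
    and T: "T \<subseteq> C" "\<forall>t\<in>T. N t \<inter> T = {}"
  shows "x \<in> U - C \<Longrightarrow> N x \<inter> (U - (C - T)) = N x \<inter> U"
    and "isolated (U - (C - T)) = (isolated U - C) \<union> T"
    and "quiet U \<Longrightarrow> quiet (U - (C - T))"
    and "attached (U - (C - T)) = {b \<in> attached U. N b \<inter> U \<subseteq> U - C}"
proof -
  show 1: "N x \<inter> (U - (C - T)) = N x \<inter> U" if "x \<in> U - C" for x
    using that C(2) N_sym by blast
  have 2: "N t \<inter> (U - (C - T)) = {}" if "t \<in> T" for t using that T C by blast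
  show 3: "isolated (U - (C - T)) = (isolated U - C) \<union> T"
  proof -
    have "x \<in> isolated (U - (C - T)) \<longleftrightarrow> x \<in> (isolated U - C) \<union> T" for x
    proof (cases "x \<in> C")
      case True then show ?thesis using 2 T C unfolding isolated_def by blast
    next
      case False then show ?thesis using 1[of x] T C unfolding isolated_def by blast
    qed
    then show ?thesis by blast
  qed
  have out: "N w \<inter> U \<subseteq> U - C" if w: "w \<in> V" "w \<notin> U" "a \<in> N w" "a \<in> U - C" for w a
  proof
    fix c assume c: "c \<in> N w \<inter> U"
    show "c \<in> U - C"
    proof (cases "c = a")
      case False
      then have "c \<in> N a" using admissibleD[OF ok w(1,2,3), of c] w c by blast
      then have "a \<in> N c" using N_sym by blast
      then show ?thesis using c C(2) w by blast
    qed (use w in blast)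
  qed
  show "quiet (U - (C - T))" if q: "quiet U"
    unfolding quiet_def
  proof
    fix w assume w: "w \<in> V"
    show "\<not> lone (U - (C - T)) w"
    proof
      assume "lone (U - (C - T)) w"
      then obtain a where a: "w \<notin> U - (C - T)" "N w \<inter> (U - (C - T)) = {a}" "a \<notin> isolated (U - (C - T))"
        unfolding lone_def by blast
      have aU: "a \<in> U - C" "a \<notin> isolated U" "a \<in> N w" using a(2,3) 3 T by blast+
      have "w \<notin> U" using a(1) C(2) aU T by blast
      then have "N w \<inter> U = {a}" using out[OF w _ aU(3,1)] a(2) by blast
      then show False using q w \<open>w \<notin> U\<close> aU(2) unfolding quiet_def lone_def by blast
    qed
  qed
  show "attached (U - (C - T)) = {b \<in> attached U. N b \<inter> U \<subseteq> U - C}"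
  proof -
    have "b \<in> attached (U - (C - T)) \<longleftrightarrow> b \<in> attached U \<and> N b \<inter> U \<subseteq> U - C" for b
    proof
      assume "b \<in> attached (U - (C - T))"
      then obtain a where a: "b \<in> V" "b \<notin> U - (C - T)" "a \<in> N b" "a \<in> U - (C - T)" "a \<notin> isolated (U - (C - T))"
        unfolding attached_def by blast
      have aU: "a \<in> U - C" "a \<notin> isolated U" using a(4,5) 3 T by blast+
      have "b \<notin> U" using a(2,3) C(2) aU T by blast
      then show "b \<in> attached U \<and> N b \<inter> U \<subseteq> U - C" using out[OF a(1) _ a(3) aU(1)] a(1,3) aU
        unfolding attached_def by blast
    next
      assume b: "b \<in> attached U \<and> N b \<inter> U \<subseteq> U - C"
      then obtain a where "b \<in> V" "b \<notin> U" "a \<in> N b" "a \<in> U" "a \<notin> isolated U" unfolding attached_def by blast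
      then show "b \<in> attached (U - (C - T))" using b T unfolding attached_def 3 by blast
    qed
    then show ?thesis by blast
  qed
qed


section \<open>Positions in which no move gains 30\<close>

text \<open>
  Dominator has no move of gain \<open>30\<close>, which together with any reply of Staller, gaining at least \<open>10\<close>,
  would pay for a round.
\<close>

definition cold :: "'a set \<Rightarrow> bool" where
  "cold U \<longleftrightarrow> (\<forall>v\<in>V. Nc v \<inter> U \<noteq> {} \<longrightarrow> potential U < potential (U - Nc v) + 30)"

lemma coldD: "cold U \<Longrightarrow> x \<in> V \<Longrightarrow> x \<in> U \<Longrightarrow> potential U < potential (U - Nc x) + 30"
  unfolding cold_def Nc_def by blast

text \<open>\<open>gain_degree_ge_3\<close> bounds the degrees by 2, \<open>gain_leaf\<close> lets a
  leaf be adjacent only to a leaf, and \<open>gain_triangle\<close> excludes triangles.\<close>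

lemma cold_structure:
  assumes ok: "admissible U" and c: "cold U" and x: "x \<in> U" "x \<notin> isolated U"
  shows "(\<exists>y. N x \<inter> U = {y} \<and> N y \<inter> U = {x}) \<or> (\<exists>y u. y \<noteq> u \<and> N x \<inter> U = {y, u} \<and> u \<notin> N y)"
proof -
  have lt3: "card (N t \<inter> U) \<le> 2" if "t \<in> U" for t
    using gain_degree_ge_3[OF ok that] c unfolding cold_def by force
  have leaf: "N y \<inter> U = {t}" if t: "t \<in> U" "N t \<inter> U = {y}" for t y
  proof -
    have y: "y \<in> U" "y \<in> V" "t \<in> N y" using t N_V N_sym by blast+
    have "\<not> 2 \<le> card (N y \<inter> U)" using gain_leaf[OF ok t] coldD[OF c y(2,1)] by linarith
    moreover have "card (N y \<inter> U) \<noteq> 0" using y t(1) by auto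
    ultimately have "card (N y \<inter> U) = 1" by linarith
    then obtain s where "N y \<inter> U = {s}" using card_1_singletonE by blast
    then show ?thesis using y t by auto
  qed
  have "card (N x \<inter> U) \<noteq> 0" using x unfolding isolated_def by auto
  then consider "card (N x \<inter> U) = 1" | "card (N x \<inter> U) = 2" using lt3[OF x(1)] by linarith
  then show ?thesis
  proof cases
    case 1
    then obtain y where "N x \<inter> U = {y}" using card_1_singletonE by blast
    then show ?thesis using leaf[OF x(1)] by blast
  next
    case 2
    then obtain y u where yu: "N x \<inter> U = {y, u}" "y \<noteq> u" by (meson card_2_iff)
    have "u \<notin> N y"
    proof
      assume "u \<in> N y"
      then have "potential (U - Nc x) + 30 \<le> potential U"
        using gain_triangle[OF ok x(1) yu(1)] lt3[of y] lt3[of u] yu by blast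
      then show False using coldD[OF c _ x(1)] x(1) admissible_subset[OF ok] by force
    qed
    then show ?thesis using yu by blast
  qed
qed

lemma not_lone_degree_2:
  assumes "N v \<inter> U = {a}" "a \<in> U" "N a \<inter> U = {y, u}" "y \<noteq> u" "u \<notin> N y" "v \<notin> U"
  shows False
proof -
  have "v \<in> N a" "y \<in> N a" "u \<in> N a" "v \<noteq> y" "v \<noteq> u" using assms N_sym by blast+
  then have "y \<in> N v \<or> u \<in> N v" using claw[of v a y u] assms(4,5) by blast
  then have "y = a \<or> u = a" using assms(1,3) by blast
  then show False using assms(3) N_irrefl by blast
qed

text \<open>A lone vertex at one end of a single edge and the vertex that
  \<open>attached_leaf\<close> supplies at the other end would together yield 22 + 8 = 30. A lone
  vertex at a vertex of degree 2 would complete a claw.\<close>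

lemma cold_quiet:
  assumes ok: "admissible U" and c: "cold U"
  shows "quiet U"
  unfolding quiet_def
proof
  fix w assume w: "w \<in> V"
  show "\<not> lone U w"
  proof
    assume "lone U w"
    then obtain a where a: "w \<notin> U" "N w \<inter> U = {a}" "a \<notin> isolated U" unfolding lone_def by blast
    have aU: "a \<in> U" using a by blast
    from cold_structure[OF ok c aU a(3)] show False
    proof
      assume "\<exists>y. N a \<inter> U = {y} \<and> N y \<inter> U = {a}"
      then obtain y where y: "N a \<inter> U = {y}" "N y \<inter> U = {a}" by blast
      have yU: "y \<in> U" using y by blast
      obtain b where b: "b \<in> attached U" "b \<in> N y" "N b \<inter> U \<subseteq> {y, a}" using attached_leaf[OF ok yU y(2)] by blast
      have "w \<in> attached U" using a w aU unfolding attached_def by blast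
      moreover have "b \<noteq> w"
      proof
        assume "b = w"
        then have "y \<in> N w \<inter> U" using N_sym[OF b(2)] yU by simp
        then have "y = a" using a(2) by simp
        moreover have "y \<in> N a" using y(1) by auto
        ultimately show False using N_irrefl by simp
      qed
      moreover have "N t \<inter> U \<subseteq> {a, y}" if "t \<in> {b, w}" for t using that a(2) b(3) by auto
      ultimately have "potential (U - Nc a) + 22 + 4 * int (card {b, w}) \<le> potential U"
        using gain_pair(1)[OF ok aU y, of "{b, w}"] b(1) by auto
      then have "potential (U - Nc a) + 30 \<le> potential U" using \<open>b \<noteq> w\<close> by simp
      then show False using coldD[OF c _ aU] aU admissible_subset[OF ok] by force
    next
      assume "\<exists>y u. y \<noteq> u \<and> N a \<inter> U = {y, u} \<and> u \<notin> N y"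
      then show False using not_lone_degree_2[OF a(2) aU] a(1) by blast
    qed
  qed
qed

lemma pair_round:
  assumes ok: "admissible U" and q: "quiet U" and IH: "bounded_below E (card U)"
    and x: "x \<in> U" "N x \<inter> U = {y}" "N y \<inter> U = {x}"
  shows "dom_bound U (potential U + E)"
proof -
  have xV: "x \<in> V" using x admissible_subset[OF ok] by blast
  have yU: "y \<in> U" using x by blast
  obtain b where b: "b \<in> attached U" "b \<in> N x" "N b \<inter> U \<subseteq> {x, y}" using attached_leaf[OF ok x(1,2)] by blast
  have g: "potential (U - Nc x) + 26 \<le> potential U" and A: "Nc x \<inter> U = {x, y}"
    using gain_pair[OF ok x, of "{b}"] b by auto
  have "quiet (U - ({x, y} - {}))" using q by (intro closed_del(3)[OF ok]) (use x yU in auto)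
  moreover have "U - Nc x = U - ({x, y} - {})" using A by blast
  ultimately have "quiet (U - Nc x)" by simp
  then show ?thesis using round_quiet[OF ok xV _ IH] g A by auto
qed

section \<open>Cyclic positions\<close>

text \<open>
  The undominated vertices induce isolated vertices and cycles of length at least 5.
\<close>

definition cyclic :: "'a set \<Rightarrow> bool" where
  "cyclic U \<longleftrightarrow> admissible U \<and> (\<forall>x\<in>U - isolated U. \<exists>y u. y \<noteq> u \<and> N x \<inter> U = {y, u} \<and> u \<notin> N y \<and> N y \<inter> N u \<inter> U = {x})"

text \<open>On a 4-cycle the move \<open>x\<close> leaves only the opposite vertex, as an isolated
  one. The gain 21 + 4 - 1 = 24 is just enough, since the rest stays quiet.\<close>

lemma square_round:
  assumes ok: "admissible U" and q: "quiet U" and IH: "bounded_below E (card U)"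
    and st: "\<And>t. t \<in> U \<Longrightarrow> t \<notin> isolated U \<Longrightarrow> \<exists>y u. y \<noteq> u \<and> N t \<inter> U = {y, u} \<and> u \<notin> N y"
    and x: "x \<in> U" "N x \<inter> U = {y, u}" "y \<noteq> u" "u \<notin> N y" "z \<in> N y" "z \<in> N u" "z \<in> U" "z \<noteq> x"
  shows "dom_bound U (potential U + E)"
proof -
  have two: "N t \<inter> U = {a, b}" if "t \<in> U" "a \<in> N t \<inter> U" "b \<in> N t \<inter> U" "a \<noteq> b" for t a b
  proof -
    have t: "t \<in> U" "t \<notin> isolated U" using that unfolding isolated_def by auto
    obtain c d where "N t \<inter> U = {c, d}" using st[OF t] by blast
    then show ?thesis using that(2-4) by auto
  qed
  have xV: "x \<in> V" using x admissible_subset[OF ok] by blast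
  have m: "y \<in> U" "u \<in> U" "x \<in> N y" "x \<in> N u" "y \<in> N z" "u \<in> N z" using x N_sym by blast+
  have n: "N y \<inter> U = {x, z}" "N u \<inter> U = {x, z}" "N z \<inter> U = {y, u}"
    using two[of y x z] two[of u x z] two[of z y u] m x by auto
  have ne: "x \<noteq> y" "x \<noteq> u" "z \<noteq> y" "z \<noteq> u" using m x N_irrefl by blast+
  have A: "Nc x \<inter> U = {x, y, u}" using x unfolding Nc_def by blast
  define C where "C = {x, y, u, z}"
  have C: "C \<subseteq> U" "\<forall>t\<in>C. N t \<inter> U \<subseteq> C" "{z} \<subseteq> C" "\<forall>t\<in>{z}. N t \<inter> {z} = {}"
    using x m n N_irrefl unfolding C_def by auto
  have eq: "U - Nc x = U - (C - {z})" using A ne x(8) unfolding C_def by blast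
  note cd = closed_del[OF ok C, folded eq]
  have ni: "Nc x \<inter> isolated U = {}" using not_isolated_Nc[OF x(1)] x(2) by blast
  have X: "{x} \<subseteq> Nc x \<inter> U \<union> attached U" using A by blast
  have "isolated (U - Nc x) - isolated U \<subseteq> {z}" using cd(2) by blast
  then have "card (isolated (U - Nc x) - isolated U) \<le> 1" using card_mono[of "{z}"] by force
  then have "potential (U - Nc x) + 24 \<le> potential U"
    using move_gain(1)[OF ok xV ni X] Nc_gone[of x U] ne x(3) unfolding A by auto
  then show ?thesis using round_quiet[OF ok xV _ IH cd(3)[OF q]] A by auto
qed

lemma cyclic_admissible: "cyclic U \<Longrightarrow> admissible U" unfolding cyclic_def by blast

lemma cyclicD:
  assumes "cyclic U" "x \<in> U" "y \<in> N x" "y \<in> U"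
  shows "\<exists>z. N x \<inter> U = {y, z} \<and> z \<noteq> y \<and> z \<notin> N y \<and> y \<notin> N z \<and> N y \<inter> N z \<inter> U = {x}"
proof -
  have "x \<notin> isolated U" using assms unfolding isolated_def by blast
  then obtain a b where ab: "a \<noteq> b" "N x \<inter> U = {a, b}" "b \<notin> N a" "N a \<inter> N b \<inter> U = {x}"
    using assms unfolding cyclic_def by blast
  have "y = a \<or> y = b" using ab assms by blast
  then show ?thesis
  proof
    assume "y = a" then show ?thesis using ab N_sym by blast
  next
    assume "y = b" then show ?thesis using ab N_sym[of b a] N_sym[of a b] by (intro exI[of _ a]) auto
  qed
qed

lemma cyclic_two:
  assumes "cyclic U" "t \<in> U" "a \<in> N t" "a \<in> U" "b \<in> N t" "b \<in> U" "a \<noteq> b"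
  shows "N t \<inter> U = {a, b}"
proof -
  obtain c where "N t \<inter> U = {a, c}" using cyclicD[OF assms(1-4)] by blast
  moreover have "b \<in> N t \<inter> U" using assms by simp
  ultimately show ?thesis using assms(7) by auto
qed

section \<open>Opening a cycle\<close>

text \<open>For the position after an opening, where \<open>s\<close> and \<open>w\<close> are the
  ends of the remaining path. Lone replies exist only at these ends. A reply worth 10 instead of 11
  must isolate a leaf next to the removed end, and this can only be the other end.\<close>

lemma ends_reply:
  assumes ok: "admissible U" and st: "\<And>t. t \<in> U \<Longrightarrow> t \<notin> isolated U \<Longrightarrow> t \<notin> {s, w} \<Longrightarrow> \<exists>y u. y \<noteq> u \<and> N t \<inter> U = {y, u} \<and> u \<notin> N y"
    and v: "v \<in> V" "Nc v \<inter> U \<noteq> {}"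
  shows "potential (U - Nc v) + 16 \<le> potential U \<or>
    (\<exists>a\<in>{s, w}. U - Nc v = U - {a} \<and> potential (U - Nc v) + 10 \<le> potential U \<and>
       (w \<notin> N s \<longrightarrow> potential (U - Nc v) + 11 \<le> potential U))"
proof (cases "lone U v")
  case False
  then show ?thesis using staller_gain(2)[OF ok v] by blast
next
  case True
  then obtain a where a: "v \<notin> U" "N v \<inter> U = {a}" "a \<notin> isolated U" unfolding lone_def by blast
  have aU: "a \<in> U" using a by blast
  have asw: "a \<in> {s, w}" using st[OF aU a(3)] not_lone_degree_2[OF a(2) aU] a(1) by blast
  have A: "Nc v \<inter> U = {a}" using a unfolding Nc_def by blast
  have eq: "U - Nc v = U - {a}" using A by blast
  have "potential (U - Nc v) + 11 \<le> potential U" if ws: "w \<notin> N s"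
  proof -
    have "Nc v \<inter> isolated U \<subseteq> Nc v \<inter> U" unfolding isolated_def by auto
    then have ni: "Nc v \<inter> isolated U = {}" using A a(3) by auto
    have X: "{v} \<subseteq> Nc v \<inter> U \<union> attached U" using not_isolated_move[OF ok v ni] by blast
    have Z0: "isolated (U - Nc v) - isolated U = {}"
    proof (rule ccontr)
      assume "\<not> ?thesis"
      then obtain z where z: "z \<in> isolated (U - {a})" "z \<notin> isolated U" unfolding eq by blast
      have nz: "z \<in> U" "z \<noteq> a" "N z \<inter> U = {a}" using z unfolding isolated_def by auto
      have "z \<in> {s, w}"
      proof (rule ccontr)
        assume "z \<notin> {s, w}"
        from st[OF nz(1) z(2) this] obtain y u where "y \<noteq> u" "N z \<inter> U = {y, u}" by blast
        then show False using nz(3) by auto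
      qed
      moreover have "a \<in> N z" "z \<in> N a" using nz N_sym by blast+
      ultimately show False using asw ws nz(2) N_sym by auto
    qed
    show ?thesis using move_gain(1)[OF ok v(1) ni X] Nc_gone[of v U] unfolding A Z0 by simp
  qed
  then show ?thesis using staller_gain(1)[OF ok v] asw eq by blast
qed

text \<open>The path left by the move \<open>x\<close> has the ends \<open>z\<close> and
  \<open>w\<close>. As the cycle has length at least 5, both keep an undominated neighbour, so
  nothing is isolated and the gain is 21 + 4 plus 4 for each vertex of \<open>X\<close>.\<close>

lemma cyclic_open:
  assumes c: "cyclic U" and x: "x \<in> U" "N x \<inter> U = {y, u}" "N y \<inter> U = {x, z}" "N u \<inter> U = {x, w}"
    and ne: "y \<noteq> u"
    and X: "X \<subseteq> attached U" "\<forall>b\<in>X. N b \<inter> U \<subseteq> {x, y, u}"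
  shows "distinct [x, y, u, z, w]" "{x, y, u, z, w} \<subseteq> U" "Nc x \<inter> U = {x, y, u}"
    "isolated (U - Nc x) = isolated U"
    "\<And>t. t \<in> U - Nc x \<Longrightarrow> t \<notin> {z, w} \<Longrightarrow> N t \<inter> (U - Nc x) = N t \<inter> U"
    "\<And>t. t \<in> U - Nc x \<Longrightarrow> t \<notin> isolated (U - Nc x) \<Longrightarrow> t \<notin> {z, w} \<Longrightarrow>
       \<exists>a b. a \<noteq> b \<and> N t \<inter> (U - Nc x) = {a, b} \<and> b \<notin> N a"
    "potential (U - Nc x) + 25 + 4 * int (card X) \<le> potential U"
proof -
  note ok = cyclic_admissible[OF c]
  have m: "y \<in> U" "u \<in> U" "z \<in> U" "w \<in> U" "y \<in> N x" "u \<in> N x" using x by blast+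
  have yu: "u \<notin> N y" "N y \<inter> N u \<inter> U = {x}" "y \<notin> N u" using cyclicD[OF c x(1) m(5,1)] x(2) ne by (auto simp: doubleton_eq_iff)
  have yz: "z \<noteq> x" using cyclicD[OF c m(1) N_sym[OF m(5)] x(1)] x(3) by (auto simp: doubleton_eq_iff)
  have uw: "w \<noteq> x" using cyclicD[OF c m(2) N_sym[OF m(6)] x(1)] x(4) by (auto simp: doubleton_eq_iff)
  have zw: "z \<noteq> w" using yu(2) x yz by blast
  have irr: "x \<noteq> y" "x \<noteq> u" "z \<noteq> y" "w \<noteq> u" using x N_irrefl by blast+
  have zu: "z \<noteq> u" "w \<noteq> y" using yu(1,3) x by blast+
  show d: "distinct [x, y, u, z, w]" using yz uw zw irr zu ne by auto
  show sub: "{x, y, u, z, w} \<subseteq> U" using m x by blast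
  show A: "Nc x \<inter> U = {x, y, u}" using x unfolding Nc_def by blast
  show away: "N t \<inter> (U - Nc x) = N t \<inter> U" if "t \<in> U - Nc x" "t \<notin> {z, w}" for t
  proof -
    have "t \<notin> {x, y, u}" using that A by blast
    then have "x \<notin> N t" "y \<notin> N t" "u \<notin> N t" using x(2,3,4) that N_sym by blast+
    then have "s \<notin> N t" if "s \<in> Nc x \<inter> U" for s using that A by auto
    then show ?thesis by blast
  qed
  have m': "z \<in> N y" "w \<in> N u" using x(3,4) by auto
  \<comment> \<open>The next vertices beyond the ends; in a 5-cycle \<open>p\<close> is
    \<open>w\<close> and \<open>q\<close> is \<open>z\<close>.\<close>
  obtain p where p: "N z \<inter> U = {y, p}" "p \<noteq> y" using cyclicD[OF c m(3) N_sym[OF m'(1)] m(1)] by blast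
  obtain q where q: "N w \<inter> U = {u, q}" "q \<noteq> u" using cyclicD[OF c m(4) N_sym[OF m'(2)] m(2)] by blast
  have "p \<in> N z" "q \<in> N w" using p(1) q(1) by auto
  then have "z \<in> N p \<inter> U" "w \<in> N q \<inter> U" using N_sym m by auto
  then have "p \<notin> {x, u}" "q \<notin> {x, y}" using x(2,3,4) d by auto
  then have "p \<notin> {x, y, u}" "q \<notin> {x, y, u}" using p(2) q(2) by auto
  then have nzw: "p \<in> N z \<inter> (U - Nc x)" "q \<in> N w \<inter> (U - Nc x)" using A p q by blast+
  show isoe: "isolated (U - Nc x) = isolated U"
  proof -
    have "t \<in> isolated (U - Nc x) \<longleftrightarrow> t \<in> isolated U" for t
    proof (cases "t \<in> {z, w}")
      case True then show ?thesis using nzw unfolding isolated_def by blast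
    next
      case False
      have "{x, y, u} \<inter> isolated U = {}" using x m unfolding isolated_def by blast
      then show ?thesis using away[OF _ False] A unfolding isolated_def by blast
    qed
    then show ?thesis by blast
  qed
  show "\<exists>a b. a \<noteq> b \<and> N t \<inter> (U - Nc x) = {a, b} \<and> b \<notin> N a"
    if t: "t \<in> U - Nc x" "t \<notin> isolated (U - Nc x)" "t \<notin> {z, w}" for t
  proof -
    have "t \<in> U - isolated U" using t isoe by blast
    then obtain a b where "a \<noteq> b" "N t \<inter> U = {a, b}" "b \<notin> N a" using c unfolding cyclic_def by blast
    then show ?thesis using away[OF t(1,3)] by auto
  qed
  have xV: "x \<in> V" using x admissible_subset[OF ok] by blast
  have ni: "Nc x \<inter> isolated U = {}" using not_isolated_Nc[OF x(1)] x(2) by blast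
  have X1: "insert x X \<subseteq> Nc x \<inter> U \<union> attached U" using A X by blast
  have X2: "N t \<inter> (U - Nc x) = {}" if t: "t \<in> insert x X" for t
  proof (cases "t = x")
    case False then have "N t \<inter> U \<subseteq> Nc x \<inter> U" using t X(2) A by auto
    then show ?thesis by blast
  qed (simp add: Nc_gone)
  have "x \<notin> X" using X x unfolding attached_def by blast
  moreover have "finite X" using X finite_att finite_subset by blast
  ultimately have "card (insert x X) = Suc (card X)" by simp
  then show "potential (U - Nc x) + 25 + 4 * int (card X) \<le> potential U"
    using move_gain(1)[OF ok xV ni X1 X2] irr ne unfolding A isoe by simp
qed

text \<open>If \<open>b\<close> sees \<open>x\<close>, then \<open>b\<close> and the two
  non-adjacent cycle neighbours of \<open>x\<close> would form a claw, so \<open>b\<close> sees one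
  of these; it cannot see both, because it sees a clique.\<close>

lemma cyclic_attached:
  assumes c: "cyclic U" and b: "b \<in> attached U"
  shows "\<exists>x y. x \<in> U \<and> y \<in> U \<and> y \<in> N x \<and> N b \<inter> U = {x, y} \<and> b \<notin> U"
proof -
  obtain x where x: "b \<in> V" "b \<notin> U" "x \<in> N b" "x \<in> U" "x \<notin> isolated U" using b unfolding attached_def by blast
  obtain y u where yu: "y \<noteq> u" "N x \<inter> U = {y, u}" "u \<notin> N y" using c x unfolding cyclic_def by blast
  note cl = admissibleD[OF cyclic_admissible[OF c] x(1,2)]
  have bx: "b \<in> N x" "y \<in> N x" "u \<in> N x" "y \<in> U" "u \<in> U" using yu x N_sym by blast+
  have "b \<noteq> y" "b \<noteq> u" using bx x by blast+
  then have "y \<in> N b \<or> u \<in> N b" using claw[of b x y u] bx yu by blast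
  moreover have "t = x \<or> t = y \<or> t = u" if "t \<in> N b \<inter> U" for t
    using cl[of x t] x that yu(2) by blast
  moreover have "\<not> (y \<in> N b \<and> u \<in> N b)" using cl[of y u] bx yu by blast
  ultimately have "N b \<inter> U = {x, y} \<or> N b \<inter> U = {x, u}" using bx x by blast
  then show ?thesis using x bx by blast
qed

text \<open>
  \<open>b\<close> is adjacent to the edge \<open>x y\<close> of the undominated 5-cycle \<open>x, y, z, w, u\<close>.
\<close>

definition on_five_cycle :: "'a set \<Rightarrow> 'a \<Rightarrow> bool" where
  "on_five_cycle U b \<longleftrightarrow> (\<exists>x y z w u. N b \<inter> U = {x, y} \<and> N x \<inter> U = {y, u} \<and> N y \<inter> U = {x, z} \<and> N u \<inter> U = {x, w}
      \<and> N z \<inter> U = {y, w} \<and> N w \<inter> U = {z, u} \<and> y \<noteq> u)"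

lemma on_five_cycleE:
  assumes "on_five_cycle U b"
  obtains x y z w u where "N b \<inter> U = {x, y}" "N x \<inter> U = {y, u}" "N y \<inter> U = {x, z}" "N u \<inter> U = {x, w}"
    "N z \<inter> U = {y, w}" "N w \<inter> U = {z, u}" "y \<noteq> u"
  using assms unfolding on_five_cycle_def by (elim exE conjE) (rule that)

lemma cyclic_attached_open:
  assumes c: "cyclic U" and b: "b \<in> attached U"
  obtains x y u z w where "x \<in> U" "N b \<inter> U = {x, y}" "N x \<inter> U = {y, u}" "N y \<inter> U = {x, z}" "N u \<inter> U = {x, w}" "y \<noteq> u"
proof -
  obtain x y where x: "x \<in> U" "y \<in> U" "y \<in> N x" "N b \<inter> U = {x, y}" "b \<notin> U" using cyclic_attached[OF c b] by blast
  obtain u where u: "N x \<inter> U = {y, u}" "u \<noteq> y" using cyclicD[OF c x(1,3,2)] by blast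
  obtain z where z: "N y \<inter> U = {x, z}" using cyclicD[OF c x(2) N_sym[OF x(3)] x(1)] by blast
  have "u \<in> N x" "u \<in> U" using u by blast+
  then obtain w where w: "N u \<inter> U = {x, w}" using cyclicD[OF c _ N_sym x(1)] by blast
  show thesis using that[OF x(1,4) u(1) z w] u(2) by blast
qed

text \<open>Opening at an end of the edge seen by \<open>b\<close> strips \<open>b\<close> as well,
  for a gain of 29. The cycle has length at least 6, so the ends of the path are not adjacent and
  every reply gains at least 11.\<close>

lemma long_cycle_round:
  assumes c: "cyclic U" and b: "b \<in> attached U" "\<not> on_five_cycle U b" and IH: "bounded_below E (card U)"
  shows "dom_bound U (potential U + E)"
proof -
  note ok = cyclic_admissible[OF c]
  obtain x y u z w where x: "x \<in> U" "N b \<inter> U = {x, y}" "N x \<inter> U = {y, u}" "N y \<inter> U = {x, z}" "N u \<inter> U = {x, w}" "y \<noteq> u"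
    using cyclic_attached_open[OF c b(1)] by metis
  have xV: "x \<in> V" using x admissible_subset[OF ok] by blast
  have "{b} \<subseteq> attached U" "\<forall>t\<in>{b}. N t \<inter> U \<subseteq> {x, y, u}" using b x by auto
  note co = cyclic_open[OF c x(1,3,4,5,6) this]
  have zw: "w \<notin> N z"
  proof
    assume wz: "w \<in> N z"
    have m: "y \<in> U" "u \<in> U" "z \<in> U" "w \<in> U" "y \<noteq> w" "z \<noteq> u" using co(1,2) by auto
    have m': "z \<in> N y" "w \<in> N u" using x(4,5) by blast+
    have "N z \<inter> U = {y, w}" using cyclic_two[OF c m(3) N_sym[OF m'(1)] m(1) wz m(4,5)] .
    moreover have "N w \<inter> U = {z, u}" using cyclic_two[OF c m(4) N_sym[OF wz] m(3) N_sym[OF m'(2)] m(2,6)] .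
    ultimately show False using b(2) x unfolding on_five_cycle_def by blast
  qed
  have leg: "Nc x \<inter> U \<noteq> {}" using co(3) by blast
  have g: "potential (U - Nc x) + 29 \<le> potential U" using co(7) by simp
  show ?thesis
  proof (rule dom_bound_move[OF xV leg])
    show "20 \<le> potential U + E" using g potential_nonneg[of "U - Nc x"] IH unfolding bounded_below_def by linarith
    fix v assume v: "v \<in> V" "Nc v \<inter> (U - Nc x) \<noteq> {}"
    have "potential (U - Nc x - Nc v) + 11 \<le> potential (U - Nc x)" using ends_reply[OF admissible_move[OF ok] co(6) v] zw by fastforce
    then show "dom_bound (U - Nc x - Nc v) (potential U + E - 40)"
      using bounded_belowD[OF IH card_move_less(2)[OF ok leg] admissible_move[OF admissible_move[OF ok]]] g by force
  qed
qed

definition cyclic5 :: "'a set \<Rightarrow> bool" where "cyclic5 U \<longleftrightarrow> cyclic U \<and> (\<forall>b\<in>attached U. on_five_cycle U b)"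

lemma cyclic5_del:
  assumes c: "cyclic5 U" and C: "C \<subseteq> U" "\<forall>x\<in>C. N x \<inter> U \<subseteq> C"
    and T: "T \<subseteq> C" "\<forall>t\<in>T. N t \<inter> T = {}" and ok': "admissible (U - (C - T))"
  shows "cyclic5 (U - (C - T))"
proof -
  have ok: "admissible U" using c cyclic_admissible unfolding cyclic5_def by blast
  note cd = closed_del[OF ok C T]
  have step: "t \<in> U - C" if "s \<in> U - C" "t \<in> N s \<inter> U" for s t using that C N_sym by blast
  have "cyclic (U - (C - T))" unfolding cyclic_def
  proof (intro conjI ballI ok')
    fix x assume x: "x \<in> U - (C - T) - isolated (U - (C - T))"
    then have xC: "x \<in> U - C" "x \<notin> isolated U" using cd(2) by blast+
    then obtain y u where yu: "y \<noteq> u" "N x \<inter> U = {y, u}" "u \<notin> N y" "N y \<inter> N u \<inter> U = {x}"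
      using c unfolding cyclic5_def cyclic_def by blast
    then show "\<exists>y u. y \<noteq> u \<and> N x \<inter> (U - (C - T)) = {y, u} \<and> u \<notin> N y \<and> N y \<inter> N u \<inter> (U - (C - T)) = {x}"
      using cd(1)[OF xC(1)] x by blast
  qed
  moreover have "on_five_cycle (U - (C - T)) b" if "b \<in> attached (U - (C - T))" for b
  proof -
    have b: "b \<in> attached U" "N b \<inter> U \<subseteq> U - C" using that cd(4) by blast+
    obtain x y z w u where f: "N b \<inter> U = {x, y}" "N x \<inter> U = {y, u}" "N y \<inter> U = {x, z}" "N u \<inter> U = {x, w}"
      "N z \<inter> U = {y, w}" "N w \<inter> U = {z, u}" "y \<noteq> u"
      by (rule on_five_cycleE[of U b]) (use c b(1) in \<open>auto simp: cyclic5_def\<close>)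
    have m: "x \<in> U - C" "y \<in> U - C" using f(1) b(2) by blast+
    have m': "u \<in> U - C" "z \<in> U - C" using step[OF m(1)] step[OF m(2)] f(2,3) by blast+
    have m'': "w \<in> U - C" using step[OF m'(1)] f(4) by blast
    have "N b \<inter> (U - (C - T)) = N b \<inter> U" using b(2) by blast
    then show ?thesis unfolding on_five_cycle_def
      using f cd(1)[OF m(1)] cd(1)[OF m(2)] cd(1)[OF m'(1)] cd(1)[OF m'(2)] cd(1)[OF m'']
      by (intro exI[of _ x] exI[of _ y] exI[of _ z] exI[of _ w] exI[of _ u]) simp
  qed
  ultimately show ?thesis unfolding cyclic5_def by blast
qed

lemma no_elements: "\<forall>b\<in>{}. P b" by simp

lemma cyclic_walk:
  assumes c: "cyclic U" and x: "x \<in> U" "x \<notin> isolated U"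
  obtains y u z w where "N x \<inter> U = {y, u}" "N y \<inter> U = {x, z}" "N u \<inter> U = {x, w}" "y \<noteq> u"
proof -
  obtain y u where yu: "y \<noteq> u" "N x \<inter> U = {y, u}" using c x unfolding cyclic_def by blast
  then have m: "y \<in> U" "u \<in> U" "x \<in> N y" "x \<in> N u" using N_sym by blast+
  obtain z where "N y \<inter> U = {x, z}" using cyclicD[OF c m(1,3) x(1)] by blast
  moreover obtain w where "N u \<inter> U = {x, w}" using cyclicD[OF c m(2,4) x(1)] by blast
  ultimately show thesis using that yu by blast
qed

section \<open>Tempo moves on isolated vertices\<close>

text \<open>
  Isolated vertices are tempo moves: Dominator takes one, and either Staller takes another one, which
  keeps their number odd, or Staller has to open a cycle, which is good for Dominator.
\<close>

lemma odd_round: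
  assumes c: "cyclic5 U" and odd: "odd (card (isolated U))" and IH: "bounded_below E (card U)" and E: "E \<le> 5"
    and odd_IH: "\<And>U'. card U' < card U \<Longrightarrow> cyclic5 U' \<Longrightarrow> odd (card (isolated U')) \<Longrightarrow> dom_bound U' (potential U')"
  shows "dom_bound U (potential U)"
proof -
  have ok: "admissible U" using c cyclic_admissible unfolding cyclic5_def by blast
  have fI: "finite (isolated U)" using admissible_finite[OF ok] unfolding isolated_def by auto
  have "isolated U \<noteq> {}" using odd by auto
  then obtain i where i: "i \<in> isolated U" by blast
  then have iU: "i \<in> U" "i \<in> V" "N i \<inter> U = {}" using admissible_subset[OF ok] unfolding isolated_def by blast+
  note im = isolated_move[OF ok iU(2) _ i]
  have ii: "i \<in> Nc i" unfolding Nc_def by blast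
  note im = im[OF ii]
  have leg: "Nc i \<inter> U \<noteq> {}" using im(1) by blast
  have ok1: "admissible (U - {i})" using admissible_move[OF ok, of i] im(2) by simp
  have c1: "cyclic5 (U - {i})" using cyclic5_del[OF c, of "{i}" "{}"] iU ok1 by auto
  show ?thesis
  proof (rule dom_bound_move[OF iU(2) leg])
    show "20 \<le> potential U" using im(5) potential_nonneg[of "U - {i}"] by linarith
    fix v assume v: "v \<in> V" "Nc v \<inter> (U - Nc i) \<noteq> {}"
    then have v': "Nc v \<inter> (U - {i}) \<noteq> {}" using im(2) by simp
    have lt: "card (U - {i} - Nc v) < card U" using card_move_less(2)[OF ok leg, of v] im(2) by simp
    have ok2: "admissible (U - {i} - Nc v)" using admissible_move[OF ok1] .
    have "dom_bound (U - {i} - Nc v) (potential U - 40)"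
    proof (cases "Nc v \<inter> isolated (U - {i}) = {}")
      case False
      then obtain j where j: "j \<in> Nc v" "j \<in> isolated (U - {i})" by blast
      note jm = isolated_move[OF ok1 v(1) j]
      have jU: "j \<in> isolated U" "j \<noteq> i" using j(2) im(3) by auto
      then have jN: "j \<in> U" "N j \<inter> U = {}" unfolding isolated_def by auto
      have eq: "U - {i} - Nc v = U - ({i, j} - {})" using jm(2) by blast
      have "cyclic5 (U - ({i, j} - {}))"
        by (rule cyclic5_del[OF c]) (use iU jN ok2[unfolded eq] in simp_all)
      then have c2: "cyclic5 (U - {i} - Nc v)" unfolding eq .
      have "isolated (U - {i} - Nc v) = isolated U - {i} - {j}" using jm(2,3) im(3) by simp
      moreover have "card (isolated U) = Suc (card (isolated U - {i}))" by (rule card.remove[OF fI i])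
      moreover have "card (isolated U - {i}) = Suc (card (isolated U - {i} - {j}))"
        by (rule card.remove) (use fI jU in auto)
      ultimately have "card (isolated U) = Suc (Suc (card (isolated (U - {i} - Nc v))))" by (simp only:)
      then have "odd (card (isolated (U - {i} - Nc v)))" using odd by simp
      then have "dom_bound (U - {i} - Nc v) (potential (U - {i} - Nc v))" using odd_IH[OF lt] c2 by blast
      then show ?thesis using jm(2,5) im(5) by simp
    next
      case ni: True
      have cc: "cyclic (U - {i})" using c1 unfolding cyclic5_def by blast
      show ?thesis
      proof (cases "v \<in> U - {i}")
        case True
        then have "v \<notin> isolated (U - {i})" using ni unfolding Nc_def by blast
        then obtain y u z w where w: "N v \<inter> (U - {i}) = {y, u}" "N y \<inter> (U - {i}) = {v, z}"
            "N u \<inter> (U - {i}) = {v, w}" "y \<noteq> u"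
          using cyclic_walk[OF cc True] by metis
        \<comment> \<open>Staller opens a cycle himself: 20 + 25 = 45 covers a deficit up to
          5.\<close>
        have "potential (U - {i} - Nc v) + 25 \<le> potential (U - {i})" using cyclic_open(7)[OF cc True w, of "{}"] by simp
        then show ?thesis using bounded_belowD[OF IH lt ok2] im(5) E by force
      next
        \<comment> \<open>Staller plays a vertex attached to a 5-cycle and dominates
          \<open>x\<close> and \<open>y\<close>. The path \<open>z, w, u\<close> is left, and its
          middle \<open>w\<close> strips all five vertices of the cycle: 21 + 20 = 41. So 20 + 16 +
          41 = 77 has been gained when 70 plus the deficit is needed.\<close>
        case False
        then have va: "v \<in> attached (U - {i})" using not_isolated_move[OF ok1 v(1) v' ni] by blast
        obtain x y z w u where f: "N v \<inter> (U - {i}) = {x, y}" "N x \<inter> (U - {i}) = {y, u}"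
            "N y \<inter> (U - {i}) = {x, z}" "N u \<inter> (U - {i}) = {x, w}"
            "N z \<inter> (U - {i}) = {y, w}" "N w \<inter> (U - {i}) = {z, u}" "y \<noteq> u"
          by (rule on_five_cycleE[of "U - {i}" v]) (use c1 va in \<open>auto simp: cyclic5_def\<close>)
        define W where "W = U - {i}"
        have xW: "x \<in> W" using f(1) unfolding W_def by blast
        note f = f[folded W_def]
        note co = cyclic_open[OF cc[folded W_def] xW f(2,3,4,7) empty_subsetI no_elements]
        have d: "distinct [x, y, u, z, w]" "{x, y, u, z, w} \<subseteq> W" using co(1,2) by auto
        have A: "Nc v \<inter> W = {x, y}" using f(1) False unfolding Nc_def W_def by blast
        define W2 where "W2 = W - Nc v"
        have W2: "W2 = W - {x, y}" unfolding W2_def using A by blast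
        have okW2: "admissible W2" using ok2 unfolding W2_def W_def .
        have okW: "admissible W" using ok1 unfolding W_def .
        have "\<not> lone W v" using f(1) d(1) unfolding lone_def by (auto simp: doubleton_eq_iff)
        then have g2: "potential W2 + 16 \<le> potential W" using staller_gain(2)[OF okW v(1)] v' unfolding W2_def W_def by simp
        have NW2: "N w \<inter> W2 = {z, u}" "N z \<inter> W2 = {w}" "N u \<inter> W2 = {w}" "N x \<inter> W2 = {u}" "N y \<inter> W2 = {z}"
          using f d(1) unfolding W2 by auto
        have mW2: "w \<in> W2" "z \<in> W2" "u \<in> W2" using d unfolding W2 by auto
        have wV: "w \<in> V" and xyV: "x \<in> V" "y \<in> V" using d admissible_subset[OF okW] by blast+
        have A2: "Nc w \<inter> W2 = {w, z, u}" using NW2 mW2 unfolding Nc_def by blast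
        have ni2: "Nc w \<inter> isolated W2 = {}" using not_isolated_Nc[OF mW2(1)] NW2 by blast
        have xy: "x \<in> attached W2" "y \<in> attached W2" using NW2 xyV mW2 unfolding attached_def isolated_def W2 by auto
        have X: "{w, z, u, x, y} \<subseteq> Nc w \<inter> W2 \<union> attached W2" using A2 xy by blast
        have X': "N t \<inter> (W2 - Nc w) = {}" if "t \<in> {w, z, u, x, y}" for t
        proof -
          have "N t \<inter> W2 \<subseteq> Nc w \<inter> W2" unfolding A2 using that NW2 by auto
          then show ?thesis by blast
        qed
        have e: "{w, z, u} \<inter> {w, z, u, x, y} = {w, z, u}" by blast
        have g3: "potential (W2 - Nc w) + 41 \<le> potential W2"
          using move_gain(1,2)[OF okW2 wV ni2 X X'] d(1) unfolding A2 e by auto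
        have IH2: "bounded_below E (card W2)" using bounded_below_mono[OF IH] lt unfolding W2_def W_def by simp
        show ?thesis unfolding W_def[symmetric] W2_def[symmetric]
          using round_any[OF okW2 wV _ IH2, of "potential U - 40"] A2 g3 g2 im(5) E unfolding W_def by auto
      qed
    qed
    then show "dom_bound (U - Nc i - Nc v) (potential U - 40)" using im(2) by simp
  qed
qed

lemma isolated_round:
  assumes ok: "admissible U" and all: "isolated U = U" "U \<noteq> {}" and IH: "bounded_below E (card U)"
  shows "dom_bound U (potential U + E)"
proof -
  obtain i where i: "i \<in> isolated U" "i \<in> U" using all by blast
  have iV: "i \<in> V" and ii: "i \<in> Nc i" using i admissible_subset[OF ok] unfolding Nc_def by blast+
  note im = isolated_move[OF ok iV ii i(1)]
  have leg: "Nc i \<inter> U \<noteq> {}" using im(1) by blast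
  show ?thesis
  proof (rule dom_bound_move[OF iV leg])
    show "20 \<le> potential U + E" using im(5) potential_nonneg[of "U - {i}"] IH unfolding bounded_below_def by linarith
    fix v assume v: "v \<in> V" "Nc v \<inter> (U - Nc i) \<noteq> {}"
    have "Nc v \<inter> isolated (U - Nc i) \<noteq> {}" using v(2) im(2,3) all by auto
    then obtain j where j: "j \<in> Nc v" "j \<in> isolated (U - Nc i)" by blast
    have "potential (U - Nc i) = potential (U - Nc i - Nc v) + 20"
      using isolated_move(2,5)[OF admissible_move[OF ok] v(1) j] by simp
    moreover have "potential U = potential (U - Nc i) + 20" using im(2,5) by simp
    ultimately show "dom_bound (U - Nc i - Nc v) (potential U + E - 40)"
      by (intro bounded_belowD[OF IH card_move_less(2)[OF ok leg] admissible_move[OF admissible_move[OF ok]]]) linarith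
  qed
qed

section \<open>Deficits on cycles of length 5 and 9\<close>

text \<open>The neighbourhoods are those in the whole graph, so for length at least 3 this is a
  component that is a cycle. Adding the length before subtracting 1 avoids truncation at index
  0.\<close>

definition closed_cycle :: "'a list \<Rightarrow> bool" where
  "closed_cycle xs \<longleftrightarrow> distinct xs \<and> (\<forall>i<length xs. N (xs ! i) =
     {xs ! ((i + 1) mod length xs), xs ! ((i + length xs - 1) mod length xs)})"

text \<open>After a deficit on a cycle, the leftover vertex \<open>t\<close> makes the number of
  isolated vertices odd, and from there on no further deficit arises.\<close>

lemma cyclic5_leave_one:
  assumes c: "cyclic5 U" and even: "even (card (isolated U))"
    and C: "C \<subseteq> U" "\<And>x. x \<in> C \<Longrightarrow> N x \<inter> U \<subseteq> C \<and> x \<notin> isolated U"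
    and t: "t \<in> C" and ok': "admissible (U - (C - {t}))"
  shows "cyclic5 (U - (C - {t}))" "odd (card (isolated (U - (C - {t}))))"
proof -
  have ok: "admissible U" using c cyclic_admissible unfolding cyclic5_def by blast
  have C2: "\<forall>x\<in>C. N x \<inter> U \<subseteq> C" using C by blast
  have T: "{t} \<subseteq> C" "\<forall>s\<in>{t}. N s \<inter> {t} = {}" using t N_irrefl by auto
  show "cyclic5 (U - (C - {t}))" by (rule cyclic5_del[OF c C(1) C2 T ok'])
  have "isolated (U - (C - {t})) = insert t (isolated U)" using closed_del(2)[OF ok C(1) C2 T] C(2) by blast
  moreover have "t \<notin> isolated U" using t C by blast
  moreover have "finite (isolated U)" using admissible_finite[OF ok] unfolding isolated_def by auto
  ultimately show "odd (card (isolated (U - (C - {t}))))" using even by simp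
qed

text \<open>
  Dominator opened a cycle at \<open>x\<close>, which leaves a deficit of 4 after a reply at the end \<open>z\<close> of the
  remaining path; his next move on this path repairs it. The cycle is traversed as
  \<open>x, y, z, p, q, r, s, a, \<dots>\<close>, and from \<open>x\<close> in the other direction as \<open>u, w, \<dots>\<close>. A deficit of 1
  remains only if the cycle has length 9.
\<close>

lemma fresh_second_round:
  assumes c: "cyclic5 U" and even: "even (card (isolated U))" and x: "x \<in> U" "N x \<inter> U = {y, u}" "N y \<inter> U = {x, z}" "N u \<inter> U = {x, w}"
    and ne: "y \<noteq> u" and wz: "w \<notin> N z" and fresh: "attached U = {}"
    and ok2: "admissible (U - {x, y, u, z})" and g: "potential (U - {x, y, u, z}) + 36 \<le> potential U"
    and IH: "bounded_below E (card U)"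
    and odd_IH: "\<And>U'. card U' < card U \<Longrightarrow> cyclic5 U' \<Longrightarrow> odd (card (isolated U')) \<Longrightarrow> dom_bound U' (potential U')"
    and nine: "\<And>xs. closed_cycle xs \<Longrightarrow> length xs = 9 \<Longrightarrow> 1 \<le> E"
  shows "dom_bound (U - {x, y, u, z}) (potential U + E - 40)"
proof -
  have cc: "cyclic U" using c unfolding cyclic5_def by blast
  note ok = cyclic_admissible[OF cc]
  note co = cyclic_open[OF cc x ne empty_subsetI no_elements]
  have d1: "distinct [x, y, u, z, w]" and s1: "{x, y, u, z, w} \<subseteq> U" using co(1,2) by auto
  have qU: "\<not> lone U v" for v
  proof
    assume "lone U v"
    then obtain a where "v \<notin> U" "N v \<inter> U = {a}" "a \<notin> isolated U" unfolding lone_def by blast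
    then have "v \<in> attached U" using N_V[of a v] unfolding attached_def by blast
    then show False using fresh by blast
  qed
  then have qU: "quiet U" unfolding quiet_def by blast
  define W where "W = U - {x, y, u, z}"
  have okW: "admissible W" using ok2 unfolding W_def .
  have IHW: "bounded_below E (card W)"
  proof -
    have "W \<subseteq> U" unfolding W_def by blast
    then show ?thesis using bounded_below_mono[OF IH] card_mono[OF admissible_finite[OF ok]] by blast
  qed
  obtain p where p: "N z \<inter> U = {y, p}" "p \<noteq> y" using cyclicD[OF cc, of z y] s1 x(3) N_sym by blast
  have pU: "p \<in> U" and zp: "z \<in> N p" using p N_sym by blast+
  have dp: "p \<notin> {x, y, u, z, w}"
  proof -
    have "p \<noteq> x" "p \<noteq> u" using zp s1 x(2,4) d1 by auto
    moreover have "p \<noteq> w" using p wz by blast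
    ultimately show ?thesis using p N_irrefl by blast
  qed
  obtain q where q: "N p \<inter> U = {z, q}" "q \<noteq> z" using cyclicD[OF cc pU zp] s1 by blast
  have qU': "q \<in> U" and pq: "p \<in> N q" using q N_sym by blast+
  have dq: "q \<notin> {x, y, u, z, p}" using pq pU x(2,3,4) dp q(2) N_irrefl by auto
  have uw: "u \<in> N w" "u \<in> U" "w \<in> U" using x(4) s1 N_sym by blast+
  have Vs: "z \<in> V" "u \<in> V" "p \<in> V" "q \<in> V" using s1 pU qU' admissible_subset[OF ok] by blast+
  have pW: "p \<in> W" and qW: "q \<in> W" and wW: "w \<in> W" using pU qU' dp dq uw d1 unfolding W_def by auto
  have pN: "N p \<inter> W = {q}" using q qW dq unfolding W_def by blast
  have zA: "z \<in> attached W" using Vs pW pN zp N_sym[OF zp] unfolding attached_def isolated_def W_def by blast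
  have niz: "z \<notin> W" "u \<notin> W" unfolding W_def by auto
  have nonis: "a \<notin> isolated U" if "N a \<inter> U = {b, t}" for a b t using that unfolding isolated_def by blast
  show ?thesis
  proof (cases "q = w")
    \<comment> \<open>Length 6: the edge \<open>p w\<close> is left, with both \<open>z\<close> and
      \<open>u\<close> attached to it. The gains 36 + 30 + 16 exceed 80.\<close>
    case True
    have wN: "N w \<inter> U = {u, p}"
      using cyclic_two[OF cc uw(3,1,2) _ pU] pq dp unfolding True by auto
    have wNW: "N w \<inter> W = {p}" using wN pW unfolding W_def by blast
    have pNW: "N p \<inter> W = {w}" using pN True by simp
    have A: "Nc p \<inter> W = {p, w}" using pNW pW unfolding Nc_def by blast
    have uA: "u \<in> attached W" using Vs wW wNW N_sym[OF uw(1)] unfolding attached_def isolated_def W_def by auto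
    have zN: "N z \<inter> W = {p}" "N u \<inter> W = {w}" using p(1) x(4) pW wW unfolding W_def by auto
    have "potential (W - Nc p) + 22 + 4 * int (card {z, u}) \<le> potential W"
      using gain_pair(1)[OF okW pW pNW wNW, of "{z, u}"] zA uA zN by auto
    moreover have "card {z, u} = 2" using d1 by auto
    ultimately have g2: "potential (W - Nc p) + 30 \<le> potential W" by simp
    show ?thesis unfolding W_def[symmetric]
    proof (rule round_quiet[OF okW Vs(3) _ IHW])
      have eq: "W - Nc p = U - ({x, y, u, z, p, w} - {})" using A unfolding W_def by blast
      show "quiet (W - Nc p)" unfolding eq
        by (rule closed_del(3)[OF ok _ _ _ _ qU]) (use s1 pU x(2,3,4) p(1) q(1) wN True in auto)
    qed (use A g2 g in \<open>auto simp: W_def\<close>)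
  next
    case qw: False
    obtain r where r: "N q \<inter> U = {p, r}" "r \<noteq> p" using cyclicD[OF cc qU' pq pU] by blast
    have rU: "r \<in> U" and qr: "q \<in> N r" using r N_sym by blast+
    have dr: "r \<notin> {x, y, u, z, p, q}" using qr qU' x(2,3,4) p(1) dq qw r(2) N_irrefl by auto
    have rW: "r \<in> W" using rU dr unfolding W_def by blast
    have qN: "N q \<inter> W = {p, r}" using r pW rW unfolding W_def by blast
    have A: "Nc q \<inter> W = {q, p, r}" using qN qW unfolding Nc_def by blast
    have cA: "card {q, p, r} = 3" using dr dq by auto
    have ni: "Nc q \<inter> isolated W = {}" using not_isolated_Nc[OF qW] qN by blast
    have zN: "N z \<inter> W = {p}" using p(1) pW unfolding W_def by blast
    \<comment> \<open>Besides \<open>q\<close> and \<open>p\<close>, the move \<open>q\<close>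
      strips \<open>z\<close>, whose last undominated neighbour is \<open>p\<close>. This gives 33,
      or 32 if the vertex behind \<open>r\<close> becomes isolated.\<close>
    have X: "{q, p, z} \<subseteq> Nc q \<inter> W \<union> attached W" using A zA by blast
    have X': "N t \<inter> (W - Nc q) = {}" if "t \<in> {q, p, z}" for t
    proof -
      have "N t \<inter> W \<subseteq> Nc q \<inter> W" unfolding A using that qN pN zN by auto
      then show ?thesis by blast
    qed
    have cX: "card {q, p, z} = 3" using dq dp by auto
    note mg = move_gain(1,2)[OF okW Vs(4) ni X X', unfolded A cA cX]
    have leg: "Nc q \<inter> W \<noteq> {}" using A by blast
    show ?thesis
    proof (cases "r = w")
      \<comment> \<open>Length 7: nothing of the cycle is left, and 36 + 33 + 16 exceeds 80.\<close>
      case True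
      have wN: "N w \<inter> U = {u, q}" using cyclic_two[OF cc uw(3,1,2) _ qU'] qr dq unfolding True by auto
      have Z0: "isolated (W - Nc q) - isolated W = {}"
      proof (rule ccontr)
        assume "\<not> ?thesis"
        then obtain t where t: "t \<in> W" "t \<notin> Nc q" "N t \<inter> W \<noteq> {}" "N t \<inter> (W - Nc q) = {}" unfolding isolated_def by blast
        then obtain s where s: "s \<in> N t" "s \<in> {q, p, r}" using A by blast
        have "t \<in> N s \<inter> W" using s t N_sym by blast
        moreover have "N w \<inter> W = {q}" using wN qW unfolding W_def by auto
        ultimately have "t \<in> {p, r, q}" using s(2) qN pN True by auto
        then show False using t A by blast
      qed
      have g2: "potential (W - Nc q) + 33 \<le> potential W" using mg(1) unfolding Z0 by simp
      show ?thesis unfolding W_def[symmetric]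
      proof (rule round_quiet[OF okW Vs(4) leg IHW])
        have eq: "W - Nc q = U - ({x, y, u, z, p, q, w} - {})" using A True unfolding W_def by blast
        show "quiet (W - Nc q)" unfolding eq
          by (rule closed_del(3)[OF ok _ _ _ _ qU]) (use s1 pU qU' x(2,3,4) p(1) q(1) r(1) wN True in auto)
      qed (use g2 g in \<open>auto simp: W_def\<close>)
    next
      case rw: False
      obtain s where s: "N r \<inter> U = {q, s}" "s \<noteq> q" using cyclicD[OF cc rU qr qU'] by blast
      have sU: "s \<in> U" and rs: "r \<in> N s" using s N_sym by blast+
      have ds: "s \<notin> {x, y, u, z, p, q, r}" using rs rU x(2,3,4) p(1) q(1) dr rw s(2) N_irrefl by auto
      have sW: "s \<in> W" using sU ds unfolding W_def by blast
      have rN: "N r \<inter> W = {q, s}" using s sW qW unfolding W_def by blast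
      have Zs: "t = s" if "t \<in> isolated (W - Nc q) - isolated W" for t
      proof -
        from that have t: "t \<in> W" "t \<notin> Nc q" "N t \<inter> W \<noteq> {}" "N t \<inter> (W - Nc q) = {}" unfolding isolated_def by blast+
        then obtain a where a: "a \<in> N t" "a \<in> {q, p, r}" using A by blast
        have "t \<in> N a \<inter> W" using a t N_sym by blast
        then have "t \<in> {p, r, q, s}" using a qN pN rN by auto
        then show "t = s" using t A by blast
      qed
      show ?thesis
      proof (cases "s = w")
        \<comment> \<open>Length 8: only \<open>w\<close> is left, as an isolated vertex, and 36 +
          32 + 16 exceeds 80.\<close>
        case True
        have wN: "N w \<inter> U = {u, r}" using cyclic_two[OF cc uw(3,1,2) _ rU] rs dr unfolding True by auto
        have "isolated (W - Nc q) - isolated W \<subseteq> {s}" using Zs by blast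
        then have "card (isolated (W - Nc q) - isolated W) \<le> 1" using card_mono[of "{s}"] by force
        then have g2: "potential (W - Nc q) + 32 \<le> potential W" using mg(1) by simp
        show ?thesis unfolding W_def[symmetric]
        proof (rule round_quiet[OF okW Vs(4) leg IHW])
          have eq: "W - Nc q = U - ({x, y, u, z, p, q, r, w} - {w})"
            using A True ds dp d1 unfolding W_def by auto
          show "quiet (W - Nc q)" unfolding eq
            by (rule closed_del(3)[OF ok _ _ _ _ qU])
              (use s1 pU qU' rU x(2,3,4) p(1) q(1) r(1) s(1) wN True N_irrefl in auto)
        qed (use g2 g in \<open>auto simp: W_def\<close>)
      next
        \<comment> \<open>Length at least 9: a path with the ends \<open>s\<close> and
          \<open>w\<close> is left, and 36 + 33 = 69. A reply worth 11 makes 80; one worth only 10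
          requires adjacent ends, which means length 9.\<close>
        case sw: False
        define S where "S = W - Nc q"
        have S: "S = U - {x, y, u, z, p, q, r}" unfolding S_def W_def using A unfolding W_def by blast
        have okS: "admissible S" unfolding S_def using admissible_move[OF okW] .
        obtain a where a: "N s \<inter> U = {r, a}" "a \<noteq> r" using cyclicD[OF cc sU rs rU] by blast
        have aU: "a \<in> U" and sa: "s \<in> N a" using a N_sym by blast+
        have da: "a \<notin> {x, y, u, z, p, q, r, s}"
          using sa sU x(2,3,4) p(1) q(1) r(1) ds sw a(2) N_irrefl by auto
        have sS: "s \<in> S" "a \<in> S" using sU aU ds da unfolding S by auto
        have "s \<notin> isolated S" using sS a unfolding isolated_def by blast
        then have Z0: "isolated (W - Nc q) - isolated W = {}" using Zs unfolding S_def by blast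
        have g2: "potential S + 33 \<le> potential W" using mg(1) unfolding S_def Z0 by simp
        have keep: "N t \<inter> S = N t \<inter> U" if t: "t \<in> S" "t \<notin> {s, w}" for t
        proof -
          have "t \<notin> {x, y, u, z, p, q, r}" "t \<in> U" using t S by blast+
          then have "c \<notin> N t" if "c \<in> {x, y, u, z, p, q, r}" for c
          proof (intro notI)
            assume "c \<in> N t"
            then have "t \<in> N c \<inter> U" using N_sym \<open>t \<in> U\<close> by simp
            then have "t \<in> {x, y, u, z, p, q, r, s, w}"
              using that x(2,3,4) p(1) q(1) r(1) s(1) by auto
            then show False using t \<open>t \<notin> {x, y, u, z, p, q, r}\<close> by simp
          qed
          then show ?thesis unfolding S by blast
        qed
        have st: "\<exists>y u. y \<noteq> u \<and> N t \<inter> S = {y, u} \<and> u \<notin> N y" if t: "t \<in> S" "t \<notin> isolated S" "t \<notin> {s, w}" for t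
        proof -
          have "t \<in> U - isolated U" using t keep[OF t(1,3)] unfolding S isolated_def by auto
          then obtain a b where "a \<noteq> b" "N t \<inter> U = {a, b}" "b \<notin> N a" using cc unfolding cyclic_def by blast
          then show ?thesis using keep[OF t(1,3)] by auto
        qed
        show ?thesis unfolding W_def[symmetric]
        proof (rule dom_bound_move[OF Vs(4) leg])
          show "20 \<le> potential U + E - 40"
            using g g2 potential_nonneg[of S] IH unfolding W_def bounded_below_def by linarith
          fix v assume v: "v \<in> V" "Nc v \<inter> (W - Nc q) \<noteq> {}"
          have okv: "admissible (S - Nc v)" using admissible_move[OF okS] .
          have "S - Nc v \<subset> U" using s1 unfolding S by blast
          then have lt: "card (S - Nc v) < card U" by (rule psubset_card_mono[OF admissible_finite[OF ok]])
          have tot: "potential (S - Nc v) + 80 \<le> potential U \<Longrightarrow> dom_bound (S - Nc v) (potential U + E - 80)"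
            by (rule bounded_belowD[OF IH lt okv]) simp
          have "dom_bound (S - Nc v) (potential U + E - 80)"
          proof (cases "potential (S - Nc v) + 11 \<le> potential S")
            case True
            then show ?thesis using tot g g2 unfolding W_def by linarith
          next
            case False
            then obtain b where b: "b \<in> {s, w}" "S - Nc v = S - {b}" "potential (S - Nc v) + 10 \<le> potential S" "w \<in> N s"
              using ends_reply[OF okS st v(1)] v(2) unfolding S_def by force
            have "w \<in> N s \<inter> U" using b(4) uw(3) by simp
            then have aw: "a = w" using a(1) rw by auto
            have wN: "N w \<inter> U = {u, s}" using cyclic_two[OF cc uw(3,1,2) _ sU] sa ds unfolding aw by auto
            define C where "C = {x, y, u, z, w, p, q, r, s}"
            have C: "C \<subseteq> U" "\<And>t. t \<in> C \<Longrightarrow> N t \<inter> U \<subseteq> C \<and> t \<notin> isolated U"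
              using s1 pU qU' rU sU x p q r s a wN nonis unfolding C_def aw by auto
            \<comment> \<open>A dominated neighbour of \<open>C\<close> would be attached, and there
              is none; hence \<open>C\<close> is a component of the whole graph.\<close>
            have full: "N t \<subseteq> U" if "t \<in> C" for t
            proof
              fix b assume "b \<in> N t"
              then show "b \<in> U" using that C fresh N_V[of b t] N_sym[of b t] unfolding attached_def by blast
            qed
            have full': "N t = S" if "t \<in> C" "N t \<inter> U = S" for t S using full[OF that(1)] that(2) by blast
            have NC: "N x = {y, u}" "N y = {x, z}" "N u = {x, w}" "N z = {y, p}" "N p = {z, q}" "N q = {p, r}"
              "N r = {q, s}" "N s = {r, w}" "N w = {u, s}"
              using full'[OF _ x(2)] full'[OF _ x(3)] full'[OF _ x(4)] full'[OF _ p(1)] full'[OF _ q(1)]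
                full'[OF _ r(1)] full'[OF _ s(1)] full'[OF _ a(1)[unfolded aw]] full'[OF _ wN]
              by (simp_all add: C_def)
            have "distinct [x, y, z, p, q, r, s, w, u]" using d1 dp dq dr ds qw rw sw by auto
            then have "closed_cycle [x, y, z, p, q, r, s, w, u]"
              unfolding closed_cycle_def using NC by (auto simp: less_Suc_eq insert_commute)
            then have E1: "1 \<le> E" using nine by fastforce
            obtain t where t: "t \<in> C" "S - Nc v = U - (C - {t})"
            proof (cases "b = s")
              case True
              have "S - Nc v = U - (C - {w})" unfolding b(2) unfolding S C_def True using d1 dp dq dr ds qw rw sw uw s1 by auto
              then show ?thesis using that[of w] unfolding C_def by blast
            next
              case False
              then have "b = w" using b(1) by blast
              then have "S - Nc v = U - (C - {s})" unfolding b(2) unfolding S C_def using ds sw sU by auto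
              then show ?thesis using that[of s] unfolding C_def by blast
            qed
            have "dom_bound (S - Nc v) (potential (S - Nc v))"
              using odd_IH[OF lt] cyclic5_leave_one[OF c even C t(1)] okv unfolding t(2) by blast
            then show ?thesis by (rule dom_bound_mono) (use b(3) g g2 E1 in \<open>simp add: W_def\<close>)
          qed
          then show "dom_bound (W - Nc q - Nc v) (potential U + E - 40 - 40)" unfolding S_def by simp
        qed
      qed
    qed
  qed
qed

text \<open>A reply worth 16 to the opening makes at least 41. Otherwise Staller played an end of
  the path. On a 5-cycle this makes 35, or 39 with an attached vertex, and one vertex is left over
  for the odd case. On longer cycles \<open>fresh_second_round\<close> takes over.\<close>

lemma cycle_round:
  assumes c: "cyclic5 U" and even: "even (card (isolated U))" and ni: "isolated U \<noteq> U"
    and IH: "bounded_below E (card U)"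
    and odd_IH: "\<And>U'. card U' < card U \<Longrightarrow> cyclic5 U' \<Longrightarrow> odd (card (isolated U')) \<Longrightarrow> dom_bound U' (potential U')"
    and three: "\<And>v. v \<in> V \<Longrightarrow> card (N v) \<noteq> 2 \<Longrightarrow> 1 \<le> E"
    and rings: "\<And>xs. closed_cycle xs \<Longrightarrow> length xs = 5 \<Longrightarrow> 5 \<le> E" "\<And>xs. closed_cycle xs \<Longrightarrow> length xs = 9 \<Longrightarrow> 1 \<le> E"
  shows "dom_bound U (potential U + E)"
proof -
  have cc: "cyclic U" using c unfolding cyclic5_def by blast
  note ok = cyclic_admissible[OF cc]
  obtain X x y u z w where X: "X \<subseteq> attached U" "\<forall>b\<in>X. N b \<inter> U \<subseteq> {x, y, u}"
    and x: "x \<in> U" "N x \<inter> U = {y, u}" "N y \<inter> U = {x, z}" "N u \<inter> U = {x, w}" and ne: "y \<noteq> u"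
    \<comment> \<open>An attached vertex is used if there is one: it brings 4 more, and its
      neighbour \<open>x\<close> on the 5-cycle has degree at least 3 in the whole graph, so
      \<open>three\<close> grants a deficit of 1.\<close>
    and dich: "attached U = {} \<or> w \<in> N z \<and> card X = 1 \<and> 1 \<le> E"
  proof (cases "attached U = {}")
    case True
    obtain x where "x \<in> U" "x \<notin> isolated U" using ni unfolding isolated_def by blast
    then show ?thesis using cyclic_walk[OF cc] that[of "{}"] True by (metis empty_iff empty_subsetI)
  next
    case False
    then obtain b where b: "b \<in> attached U" by blast
    obtain x y z w u where f: "N b \<inter> U = {x, y}" "N x \<inter> U = {y, u}" "N y \<inter> U = {x, z}" "N u \<inter> U = {x, w}"
      "N z \<inter> U = {y, w}" "N w \<inter> U = {z, u}" "y \<noteq> u"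
      by (rule on_five_cycleE[of U b]) (use c b in \<open>auto simp: cyclic5_def\<close>)
    have xU: "x \<in> U" "y \<in> U" "u \<in> U" "x \<in> N b" using f(1,2) by auto
    then have xU: "x \<in> U" "b \<notin> U" "b \<in> N x" "y \<in> U" "u \<in> U"
      using b N_sym unfolding attached_def by auto
    have "y \<in> N x" "u \<in> N x" using f(2) by auto
    moreover have "b \<noteq> y" "b \<noteq> u" using xU by auto
    ultimately have "{b, y, u} \<subseteq> N x" "card {b, y, u} = 3" using xU(3) f(7) by simp_all
    then have "3 \<le> card (N x)" using card_mono[of "N x" "{b, y, u}"] by simp
    then have "1 \<le> E" using three[of x] xU admissible_subset[OF ok] by force
    moreover have "w \<in> N z" using f(5) by blast
    ultimately show ?thesis using that[of "{b}" x y u z w] b f xU(1) by auto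
  qed
  have xV: "x \<in> V" using x admissible_subset[OF ok] by blast
  note co = cyclic_open[OF cc x ne X]
  have leg: "Nc x \<inter> U \<noteq> {}" using co(3) by blast
  have W: "U - Nc x = U - {x, y, u}" using co(3) by blast
  have dX: "card X = 0 \<longrightarrow> attached U = {}" "attached U = {} \<longrightarrow> card X = 0" using dich X by auto
  show ?thesis
  proof (rule dom_bound_move[OF xV leg])
    show "20 \<le> potential U + E" using co(7) potential_nonneg[of "U - Nc x"] IH unfolding bounded_below_def by linarith
    fix v assume v: "v \<in> V" "Nc v \<inter> (U - Nc x) \<noteq> {}"
    have okv: "admissible (U - Nc x - Nc v)" using admissible_move[OF admissible_move[OF ok]] .
    have lt: "card (U - Nc x - Nc v) < card U" by (rule card_move_less(2)[OF ok leg])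
    show "dom_bound (U - Nc x - Nc v) (potential U + E - 40)"
    proof (cases "potential (U - Nc x - Nc v) + 16 \<le> potential (U - Nc x)")
      case True
      then show ?thesis by (intro bounded_belowD[OF IH lt okv]) (use co(7) in linarith)
    next
      case False
      then obtain a where a: "a \<in> {z, w}" "U - Nc x - Nc v = U - Nc x - {a}"
        "potential (U - Nc x - Nc v) + 10 \<le> potential (U - Nc x)"
        "w \<notin> N z \<Longrightarrow> potential (U - Nc x - Nc v) + 11 \<le> potential (U - Nc x)"
        using ends_reply[OF admissible_move[OF ok] co(6) v] by blast
      show ?thesis
      proof (cases "w \<in> N z")
        case True
        have m: "y \<in> U" "u \<in> U" "z \<in> U" "w \<in> U" "y \<noteq> w" "u \<noteq> z" using co(1,2) by auto
        have m': "z \<in> N y" "w \<in> N u" using x(3,4) by blast+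
        have zN: "N z \<inter> U = {y, w}" using cyclic_two[OF cc m(3) N_sym[OF m'(1)] m(1) True m(4,5)] .
        have wN: "N w \<inter> U = {u, z}" using cyclic_two[OF cc m(4) N_sym[OF m'(2)] m(2) N_sym[OF True] m(3,6)] .
        define C where "C = {x, y, u, z, w}"
        have C: "C \<subseteq> U" "\<And>t. t \<in> C \<Longrightarrow> N t \<inter> U \<subseteq> C \<and> t \<notin> isolated U"
          using co(2) x zN wN unfolding C_def isolated_def by auto
        obtain t where t: "t \<in> C" "U - Nc x - Nc v = U - (C - {t})"
        proof (cases "a = z")
          case True
          have "U - Nc x - Nc v = U - (C - {w})" unfolding a(2) unfolding W C_def True using co(1,2) by auto
          then show ?thesis using that[of w] unfolding C_def by blast
        next
          case False
          then have "a = w" using a(1) by blast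
          then have "U - Nc x - Nc v = U - (C - {z})" unfolding a(2) unfolding W C_def using co(1,2) by auto
          then show ?thesis using that[of z] unfolding C_def by blast
        qed
        have B: "dom_bound (U - Nc x - Nc v) (potential (U - Nc x - Nc v))"
          using odd_IH[OF lt] cyclic5_leave_one[OF c even C t(1)] okv unfolding t(2) by blast
        \<comment> \<open>This is what is missing from 25 + 10 to 40; with \<open>X\<close> empty,
          the 5-cycle is a component of the whole graph.\<close>
        have "5 \<le> E + 4 * int (card X)"
        proof (cases "attached U = {}")
          case fresh: True
          have full: "N t \<subseteq> U" if "t \<in> C" for t
          proof
            fix b assume "b \<in> N t"
            then show "b \<in> U" using that C fresh N_V[of b t] N_sym[of b t] unfolding attached_def by blast
          qed
          have full': "N t = S" if "t \<in> C" "N t \<inter> U = S" for t S using full[OF that(1)] that(2) by blast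
          have "N x = {y, u}" "N y = {x, z}" "N u = {x, w}" "N z = {y, w}" "N w = {u, z}"
            using full'[OF _ x(2)] full'[OF _ x(3)] full'[OF _ x(4)] full'[OF _ zN] full'[OF _ wN]
            by (simp_all add: C_def)
          moreover have "distinct [x, y, z, w, u]" using co(1) by auto
          ultimately have "closed_cycle [x, y, z, w, u]"
            unfolding closed_cycle_def by (auto simp: less_Suc_eq insert_commute)
          then show ?thesis using rings(1)[of "[x, y, z, w, u]"] by simp
        qed (use dich in auto)
        then show ?thesis by (intro dom_bound_mono[OF B]) (use a(3) co(7) in linarith)
      next
        case wz: False
        then have fresh: "attached U = {}" using dich by blast
        have zw: "z \<notin> N w" using wz N_sym by blast
        from a(1) consider "a = z" | "a = w" by blast
        then show ?thesis
        proof cases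
          case 1
          have eq: "U - Nc x - Nc v = U - {x, y, u, z}" unfolding a(2) unfolding W 1 by blast
          show ?thesis unfolding eq
            by (rule fresh_second_round[OF c even x ne wz fresh _ _ IH odd_IH rings(2)])
              (use okv a(4)[OF wz] co(7) in \<open>simp_all add: eq\<close>)
        next
          \<comment> \<open>The same with the cycle traversed in the other direction.\<close>
          case 2
          have eq: "U - Nc x - Nc v = U - {x, u, y, w}" unfolding a(2) unfolding W 2 by blast
          have x': "N x \<inter> U = {u, y}" using x(2) by blast
          show ?thesis unfolding eq
            by (rule fresh_second_round[OF c even x(1) x' x(4,3) ne[symmetric] zw fresh _ _ IH odd_IH rings(2)])
              (use okv a(4)[OF wz] co(7) in \<open>simp_all add: eq\<close>)
        qed
      qed
    qed
  qed
qed

section \<open>The induction over all positions\<close>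

text \<open>
  \<open>E\<close> is the deficit that can remain in the end: 5 if there is a component that is a 5-cycle, and 1
  if a 9-cycle, or a 5-cycle with a dominated neighbour, can be left over.
\<close>

lemma position_bound:
  assumes E: "0 \<le> E" "E \<le> 5"
    and three: "\<And>v. v \<in> V \<Longrightarrow> card (N v) \<noteq> 2 \<Longrightarrow> 1 \<le> E"
    and rings: "\<And>xs. closed_cycle xs \<Longrightarrow> length xs = 5 \<Longrightarrow> 5 \<le> E" "\<And>xs. closed_cycle xs \<Longrightarrow> length xs = 9 \<Longrightarrow> 1 \<le> E"
    and ok: "admissible U"
  shows "dom_bound U (potential U + E) \<and> (cyclic5 U \<and> odd (card (isolated U)) \<longrightarrow> dom_bound U (potential U))"
  using ok
\<comment> \<open>The two claims need each other: the odd case falls back on deficit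
  \<open>E\<close> once Staller plays on a cycle, and the general case relies on the odd one after a
  vertex has been left over.\<close>
proof (induction "card U" arbitrary: U rule: less_induct)
  case less
  note ok = less.prems
  have IH: "bounded_below E (card U)" unfolding bounded_below_def using less.hyps E by blast
  have odd_IH: "dom_bound U' (potential U')" if "card U' < card U" "cyclic5 U'" "odd (card (isolated U'))" for U'
    using less.hyps[OF that(1)] that cyclic_admissible unfolding cyclic5_def by blast
  have O: "dom_bound U (potential U)" if "cyclic5 U" "odd (card (isolated U))" using odd_round[OF that IH E(2) odd_IH] .
  have "dom_bound U (potential U + E)"
  proof (cases "cold U")
    case False
    then obtain v where v: "v \<in> V" "Nc v \<inter> U \<noteq> {}" "potential (U - Nc v) + 30 \<le> potential U" unfolding cold_def by force
    show ?thesis by (rule round_any[OF ok v(1,2) IH]) (use v(3) in simp)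
  next
    case True
    note st = cold_structure[OF ok True] and q = cold_quiet[OF ok True]
    consider (empty) "U = {}" | (pair) x y where "x \<in> U" "N x \<inter> U = {y}" "N y \<inter> U = {x}"
      | (no_pair) "U \<noteq> {}" "\<And>x. x \<in> U \<Longrightarrow> x \<notin> isolated U \<Longrightarrow> \<exists>y u. y \<noteq> u \<and> N x \<inter> U = {y, u} \<and> u \<notin> N y"
      using st by metis
    then show ?thesis
    proof cases
      case empty
      then show ?thesis using dom_bound_empty[of "potential U + E"] potential_nonneg[of U] E by simp
    next
      case pair
      then show ?thesis using pair_round[OF ok q IH] by blast
    next
      case no_pair
      show ?thesis
      proof (cases "cyclic U")
        case False
        then obtain x where x: "x \<in> U" "x \<notin> isolated U"
          "\<not> (\<exists>y u. y \<noteq> u \<and> N x \<inter> U = {y, u} \<and> u \<notin> N y \<and> N y \<inter> N u \<inter> U = {x})"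
          using ok unfolding cyclic_def by blast
        obtain y u where yu: "y \<noteq> u" "N x \<inter> U = {y, u}" "u \<notin> N y" using no_pair(2)[OF x(1,2)] by blast
        have "x \<in> N y \<inter> N u \<inter> U" using yu x N_sym by blast
        then obtain z where "z \<in> N y" "z \<in> N u" "z \<in> U" "z \<noteq> x" using x(3) yu by blast
        then show ?thesis using square_round[OF ok q IH no_pair(2) x(1) yu(2,1,3)] by blast
      next
        case c: True
        show ?thesis
        proof (cases "cyclic5 U")
          case False
          then show ?thesis using long_cycle_round[OF c _ _ IH] c unfolding cyclic5_def by blast
        next
          case c5: True
          show ?thesis
          proof (cases "odd (card (isolated U))")
            case True
            then show ?thesis using dom_bound_mono[OF O[OF c5]] E by simp
          next
            case False
            then show ?thesis
            proof (cases "isolated U = U")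
              case True
              then show ?thesis by (rule isolated_round[OF ok _ no_pair(1) IH])
            next
              case ni: False
              show ?thesis
                by (rule cycle_round[OF c5 _ ni IH]) (use False odd_IH three rings in blast)+
            qed
          qed
        qed
      qed
    qed
  qed
  then show ?case using O by blast
qed

lemma potential_V: "potential V = 11 * int (card V)"
proof -
  have "N x \<noteq> {}" if "x \<in> V" for x using deg2[OF that] by auto
  then have "isolated V = {}" unfolding isolated_def using N_sub by (auto simp: Int_absorb2)
  moreover have "attached V = {}" unfolding attached_def by blast
  ultimately show ?thesis unfolding potential_def by simp
qed

lemma dom_bound_V: "dom_bound V (11 * int (card V) + 5)"
  using position_bound[of 5 V] admissible_V potential_V by simp

text \<open>If all degrees are 2, then \<open>E = 0\<close> is possible. Otherwise
  \<open>E = 1\<close>, and a first move at a vertex of degree at least 3 gains the missing 1: 31 +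
  10 = 40 + 1.\<close>

lemma dom_bound_V_no_small_cycles:
  assumes "\<And>xs. closed_cycle xs \<Longrightarrow> length xs \<noteq> 5" "\<And>xs. closed_cycle xs \<Longrightarrow> length xs \<noteq> 9"
  shows "dom_bound V (11 * int (card V))"
proof (cases "\<forall>v\<in>V. card (N v) = 2")
  case True
  then show ?thesis using position_bound[of 0 V] assms admissible_V potential_V by fastforce
next
  case False
  then obtain x where x: "x \<in> V" "card (N x) \<noteq> 2" by blast
  then have "3 \<le> card (N x)" using deg2[of x] by linarith
  then have g: "potential (V - Nc x) + 31 \<le> 11 * int (card V)" using gain_fresh[OF x(1)] potential_V by simp
  have "bounded_below 1 (card V)" unfolding bounded_below_def using position_bound[of 1] assms by fastforce
  then show ?thesis using round_any[OF admissible_V x(1)] x(1) g unfolding Nc_def by simp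
qed

end

section \<open>From graphs to neighbourhoods\<close>

abbreviation nbhd :: "('a, 'b) pre_digraph \<Rightarrow> 'a \<Rightarrow> 'a set" where
  "nbhd G v \<equiv> {u. v \<rightarrow>\<^bsub>G\<^esub> u}"

lemma (in graph) card_nbhd: "card (nbhd G v) = out_degree G v"
proof -
  have "nbhd G v = head G ` out_arcs G v"
    unfolding out_arcs_def arcs_ends_def arc_to_ends_def by (auto simp: image_iff)
  moreover have "inj_on (head G) (out_arcs G v)"
    unfolding out_arcs_def inj_on_def using no_multi_arcs by (auto simp: arc_to_ends_def)
  ultimately show ?thesis unfolding out_degree_def by (simp add: card_image)
qed

lemma (in graph) claw_subgraph:
  assumes adj: "a \<rightarrow>\<^bsub>G\<^esub> b" "a \<rightarrow>\<^bsub>G\<^esub> c" "a \<rightarrow>\<^bsub>G\<^esub> d" and ne: "b \<noteq> c" "b \<noteq> d" "c \<noteq> d"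
    and non: "\<not> b \<rightarrow>\<^bsub>G\<^esub> c" "\<not> b \<rightarrow>\<^bsub>G\<^esub> d" "\<not> c \<rightarrow>\<^bsub>G\<^esub> d"
  shows "\<not> claw_free G"
proof -
  define S where "S = {a, b, c, d}"
  have S: "S \<subseteq> verts G" unfolding S_def using adj by (auto dest: adj_in_verts)
  have ind: "induced_subgraph (G \<restriction> S) G" using S by (rule induced_induce)
  interpret H: digraph "G \<restriction> S" using ind by (rule digraphI_induced)
  have ends: "(u, v) \<in> arcs_ends (G \<restriction> S) \<longleftrightarrow> u \<in> S \<and> v \<in> S \<and> u \<rightarrow>\<^bsub>G\<^esub> v" for u v
    unfolding arcs_ends_def arc_to_ends_def by (auto simp: image_iff)
  have s: "u \<rightarrow>\<^bsub>G\<^esub> v \<Longrightarrow> v \<rightarrow>\<^bsub>G\<^esub> u" for u v using sym_arcs by (rule arcs_ends_symmetric)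
  have "symmetric (G \<restriction> S)" unfolding symmetric_def sym_def using ends s by blast
  then have g: "graph (G \<restriction> S)" by (rule H.graphI)
  have irr: "\<not> u \<rightarrow>\<^bsub>G\<^esub> u" for u using adj_not_same by blast
  have ab: "a \<noteq> b" "a \<noteq> c" "a \<noteq> d" using adj irr by auto
  have ba: "b \<rightarrow>\<^bsub>G\<^esub> a" "c \<rightarrow>\<^bsub>G\<^esub> a" "d \<rightarrow>\<^bsub>G\<^esub> a" using adj s by auto
  have non': "\<not> c \<rightarrow>\<^bsub>G\<^esub> b" "\<not> d \<rightarrow>\<^bsub>G\<^esub> b" "\<not> d \<rightarrow>\<^bsub>G\<^esub> c" using non s by blast+
  have "(u, v) \<in> arcs_ends (G \<restriction> S) \<longleftrightarrow> (u, v) \<in> {a} \<times> {b, c, d} \<union> {b, c, d} \<times> {a}" for u v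
  proof -
    have "\<forall>u\<in>S. \<forall>v\<in>S. u \<rightarrow>\<^bsub>G\<^esub> v \<longleftrightarrow> (u = a) \<noteq> (v = a)"
      unfolding S_def using adj ba non non' irr ab by simp
    moreover have "(u, v) \<in> {a} \<times> {b, c, d} \<union> {b, c, d} \<times> {a} \<longleftrightarrow> u \<in> S \<and> v \<in> S \<and> (u = a) \<noteq> (v = a)"
      unfolding S_def using ab by auto
    ultimately show ?thesis using ends by blast
  qed
  then have "arcs_ends (G \<restriction> S) = {a} \<times> {b, c, d} \<union> {b, c, d} \<times> {a}"
    by (simp only: set_eq_iff split_paired_All simp_thms)
  moreover have "verts (G \<restriction> S) = {a} \<union> {b, c, d}" by (auto simp: S_def)
  moreover have "{a} \<inter> {b, c, d} = {}" "card {a} = 1" "card {b, c, d} = 3" using ab ne by simp_all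
  ultimately have "complete_bipartite_digraph 1 3 (G \<restriction> S)"
    unfolding complete_bipartite_digraph_def using g by blast
  then show ?thesis unfolding claw_free_def using ind by blast
qed

lemma claw_free_nbhdI:
  assumes "graph G" "verts G \<noteq> {}" "claw_free G" "min_degree G \<ge> 2"
  shows "claw_free_nbhd (verts G) (nbhd G)"
proof -
  interpret graph G by fact
  show ?thesis
  proof
    show "finite (verts G)" by simp
    show "nbhd G v \<subseteq> verts G" for v by (auto dest: adj_in_verts)
    show "v \<in> nbhd G u" if "u \<in> nbhd G v" for u v using that arcs_ends_symmetric[OF sym_arcs] by blast
    show "v \<notin> nbhd G v" for v using adj_not_same by blast
    show "2 \<le> card (nbhd G v)" if "v \<in> verts G" for v
    proof -
      have "min_degree G \<le> out_degree G v" unfolding min_degree_def using that by (intro Min_le) auto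
      then show ?thesis using assms(4) card_nbhd by simp
    qed
    show "c \<in> nbhd G b \<or> d \<in> nbhd G b \<or> d \<in> nbhd G c"
      if "b \<in> nbhd G a" "c \<in> nbhd G a" "d \<in> nbhd G a" "b \<noteq> c" "b \<noteq> d" "c \<noteq> d" for a b c d
      using claw_subgraph[of a b c d] that assms(3) by blast
  qed
qed

section \<open>From \<open>dom_bound\<close> to the game\<close>

text \<open>The move chosen in \<open>dom_bound\<close> bounds the minimum of Dominator from above,
  and the reply at which Staller attains the maximum is one of those that the rule covers.\<close>

lemma remaining_moves_bound:
  assumes c: "claw_free_nbhd (verts G) (nbhd G)"
    and B: "claw_free_nbhd.dom_bound (verts G) (nbhd G) U K" and U: "U = verts G - (\<Union>u\<in>D. closed_nbhd G u)"
  shows "20 * int (remaining_moves G Dominator D) \<le> K"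
proof -
  interpret claw_free_nbhd "verts G" "nbhd G" by (rule c)
  have Nc: "closed_nbhd G v = Nc v" for v unfolding closed_nbhd_def Nc_def ..
  have legal: "legal_moves G D = {v \<in> verts G. Nc v \<inter> (verts G - (\<Union>u\<in>D. closed_nbhd G u)) \<noteq> {}}" for D
  proof -
    have "v \<in> verts G \<Longrightarrow> Nc v \<subseteq> verts G" for v unfolding Nc_def using N_sub[of v] by blast
    then show ?thesis unfolding legal_moves_def Nc by blast
  qed
  have und: "verts G - (\<Union>u\<in>insert v D. closed_nbhd G u) = verts G - (\<Union>u\<in>D. closed_nbhd G u) - Nc v" for v D
    unfolding Nc by blast
  have fin: "finite (legal_moves G D)" for D unfolding legal_moves_def using finite_V by simp
  from B U show ?thesis
  proof (induction arbitrary: D rule: dom_bound.induct)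
    case (dom_bound_empty K)
    then have "legal_moves G D = {}" unfolding legal by auto
    then show ?case using dom_bound_empty by (subst remaining_moves.simps) simp
  next
    case (dom_bound_move v U K)
    have v: "v \<in> legal_moves G D" unfolding legal using dom_bound_move by simp
    have "20 * (1 + int (remaining_moves G Staller (insert v D))) \<le> K"
    proof (cases "legal_moves G (insert v D) = {}")
      \<comment> \<open>Dominator's move ends the game; the premise \<open>20 \<le> K\<close> of the
        rule is made for this case.\<close>
      case True
      then show ?thesis using dom_bound_move.hyps(3) by (subst remaining_moves.simps) simp
    next
      case False
      define R where "R = (\<lambda>w. remaining_moves G Dominator (insert w (insert v D))) ` legal_moves G (insert v D)"
      have "Max R \<in> R" unfolding R_def using fin False by (intro Max_in) auto
      then obtain w where w: "w \<in> legal_moves G (insert v D)"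
        "Max R = remaining_moves G Dominator (insert w (insert v D))" unfolding R_def by blast
      have "w \<in> verts G" "Nc w \<inter> (U - Nc v) \<noteq> {}"
        using w(1) dom_bound_move.prems unfolding legal und by auto
      then have "20 * int (Max R) \<le> K - 40"
        unfolding w(2) by (rule dom_bound_move.IH) (simp only: und dom_bound_move.prems)
      moreover have "remaining_moves G Staller (insert v D) = 1 + Max R"
        unfolding R_def using False finite_V by (subst remaining_moves.simps) simp
      ultimately show ?thesis by simp
    qed
    moreover have "remaining_moves G Dominator D \<le> 1 + remaining_moves G Staller (insert v D)"
    proof -
      have "remaining_moves G Dominator D
          = 1 + Min ((\<lambda>v. remaining_moves G Staller (insert v D)) ` legal_moves G D)"
        using v finite_V by (subst remaining_moves.simps) auto
      moreover have "Min ((\<lambda>v. remaining_moves G Staller (insert v D)) ` legal_moves G D)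
          \<le> remaining_moves G Staller (insert v D)"
        using v fin by (intro Min_le) auto
      ultimately show ?thesis by simp
    qed
    then have "20 * int (remaining_moves G Dominator D) \<le> 20 * (1 + int (remaining_moves G Staller (insert v D)))"
      by (intro mult_left_mono) simp_all
    ultimately show ?case by (rule order_trans[rotated])
  qed
qed

section \<open>Connected graphs that contain a cycle as a component\<close>

lemma (in graph) connected_closed:
  assumes "connected G" and S: "S \<noteq> {}" "S \<subseteq> verts G" "\<And>v. v \<in> S \<Longrightarrow> nbhd G v \<subseteq> S"
  shows "S = verts G"
proof -
  obtain u where u: "u \<in> S" using S by blast
  have "v \<in> S" if v: "v \<in> verts G" for v
  proof -
    have "u \<rightarrow>\<^sup>*\<^bsub>with_proj (mk_symmetric G)\<^esub> v"
      using assms(1) u v S(2) unfolding connected_def strongly_connected_def by auto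
    then have "u \<rightarrow>\<^sup>*\<^bsub>G\<^esub> v" using reachable_mk_symmetric_eq[OF sym_arcs] by simp
    then show ?thesis by (induction rule: reachable_induct) (use u S(3) in auto)
  qed
  then show ?thesis using S(2) by blast
qed

text \<open>Translates the predecessor index of \<open>closed_cycle\<close> into the symmetric
  adjacency of \<open>cycle_graph\<close>.\<close>

lemma mod_pred_iff:
  assumes "i < n" "j < (n::nat)"
  shows "j = (i + n - 1) mod n \<longleftrightarrow> i = (j + 1) mod n"
proof (cases "i = 0")
  case True
  then show ?thesis using assms by (cases "j + 1 = n") auto
next
  case False
  then have "(i + n - 1) mod n = i - 1" using assms
    by (metis Nat.add_diff_assoc2 One_nat_def Suc_leI add.commute less_imp_diff_less mod_add_self1 mod_less neq0_conv)
  then show ?thesis using assms False by (cases "j + 1 = n") auto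
qed

text \<open>The vertices of the list are closed under adjacency, so connectedness makes them all
  vertices; the isomorphism sends each vertex to its index.\<close>

lemma closed_cycle_iso:
  assumes c: "claw_free_nbhd (verts G) (nbhd G)" and g: "graph G" and con: "connected G"
    and r: "claw_free_nbhd.closed_cycle (nbhd G) xs" and ne: "xs \<noteq> []"
  shows "digraph_iso G (with_proj (cycle_graph (length xs)))"
proof -
  interpret graph G by fact
  interpret claw_free_nbhd "verts G" "nbhd G" by (rule c)
  define n where "n = length xs"
  have n0: "0 < n" unfolding n_def using ne by simp
  have d: "distinct xs" and nbs: "\<And>i. i < n \<Longrightarrow> nbhd G (xs ! i) = {xs ! ((i + 1) mod n), xs ! ((i + n - 1) mod n)}"
    using r unfolding closed_cycle_def n_def by auto
  have xV: "xs ! i \<in> verts G" if "i < n" for i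
    using nbs[OF that] by (auto dest: adj_in_verts(1))
  have "set xs = verts G"
  proof (rule connected_closed[OF con])
    show "set xs \<noteq> {}" using ne by simp
    show "set xs \<subseteq> verts G" using xV unfolding n_def by (auto simp: in_set_conv_nth)
    show "nbhd G v \<subseteq> set xs" if v: "v \<in> set xs" for v
    proof -
      obtain i where "i < n" "v = xs ! i" using v unfolding n_def by (auto simp: in_set_conv_nth)
      then show ?thesis using nbs n0 unfolding n_def by (auto intro!: nth_mem)
    qed
  qed
  then have bij: "bij_betw ((!) xs) {..<n} (verts G)" using bij_betw_nth[OF d] n_def by simp
  define f where "f = the_inv_into {..<n} ((!) xs)"
  have fb: "bij_betw f (verts G) {..<n}" unfolding f_def by (rule bij_betw_the_inv_into[OF bij])
  have ff: "xs ! f v = v" "f v < n" if "v \<in> verts G" for v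
    using f_the_inv_into_f_bij_betw[OF bij] bij_betwE[OF fb] that unfolding f_def by auto
  have fx: "f (xs ! i) = i" if "i < n" for i
    using the_inv_into_f_f[of "(!) xs" "{..<n}" i] bij that unfolding f_def bij_betw_def by simp
  \<comment> \<open>An arc is sent to the pair of indices of its ends, which is injective because
    there are no parallel arcs.\<close>
  define h where "h = \<lparr>iso_verts = f, iso_arcs = (\<lambda>e. (f (tail G e), f (head G e))),
    iso_head = snd, iso_tail = (fst :: nat \<times> nat \<Rightarrow> nat)\<rparr>"
  have inj: "inj_on f (verts G)" using fb unfolding bij_betw_def by blast
  have "digraph_isomorphism h"
    unfolding digraph_isomorphism_def
  proof (intro conjI)
    show "wf_digraph G" by unfold_locales
    show "inj_on (iso_arcs h) (arcs G)"
    proof (rule inj_onI)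
      fix e e' assume e: "e \<in> arcs G" "e' \<in> arcs G" "iso_arcs h e = iso_arcs h e'"
      then have "tail G e = tail G e'" "head G e = head G e'"
        using inj unfolding h_def inj_on_def by auto
      then show "e = e'" using e no_multi_arcs by (auto simp: arc_to_ends_def)
    qed
  qed (use inj in \<open>auto simp: h_def\<close>)
  moreover have "with_proj (cycle_graph n) = app_iso h G"
  proof -
    have "(\<lambda>e. (f (tail G e), f (head G e))) ` arcs G = {(f u, f v) | u v. u \<rightarrow>\<^bsub>G\<^esub> v}"
      unfolding arcs_ends_def arc_to_ends_def by (auto simp: image_iff)
    also have "\<dots> = {(i, j). i < n \<and> j < n \<and> (j = (i + 1) mod n \<or> i = (j + 1) mod n)}"
    proof -
      have "(\<exists>u v. i = f u \<and> j = f v \<and> u \<rightarrow>\<^bsub>G\<^esub> v) \<longleftrightarrow> i < n \<and> j < n \<and> (j = (i + 1) mod n \<or> i = (j + 1) mod n)"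
        (is "?L \<longleftrightarrow> ?R") for i j
      proof
        assume ?L
        then obtain u v where uv: "i = f u" "j = f v" "u \<rightarrow>\<^bsub>G\<^esub> v" by blast
        have V: "u \<in> verts G" "v \<in> verts G" using uv(3) by (auto dest: adj_in_verts)
        have ij: "i < n" "j < n" "xs ! i = u" "xs ! j = v" using ff V uv by auto
        then have "v \<in> {xs ! ((i + 1) mod n), xs ! ((i + n - 1) mod n)}" using nbs[of i] uv by blast
        then have "j = (i + 1) mod n \<or> j = (i + n - 1) mod n" using uv(2) fx n0 by auto
        then show ?R using ij mod_pred_iff by blast
      next
        assume R: ?R
        then have "j = (i + 1) mod n \<or> j = (i + n - 1) mod n" using mod_pred_iff by blast
        then have "xs ! j \<in> nbhd G (xs ! i)" using nbs[of i] R by auto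
        then show ?L using fx R by (intro exI[of _ "xs ! i"] exI[of _ "xs ! j"]) auto
      qed
      then show ?thesis by blast
    qed
    finally show ?thesis using fb unfolding bij_betw_def
      by (simp add: app_iso_def h_def with_proj_def cycle_graph_def)
  qed
  ultimately show ?thesis unfolding digraph_iso_def n_def by blast
qed

theorem theorem5p1:
  fixes G :: "('a, 'b) pre_digraph"
  assumes "graph G" and "verts G \<noteq> {}"
    and "claw_free G" and "min_degree G \<ge> 2"
  shows "int (game_domination_number G) \<le> \<lceil>11 / 20 * real (card (verts G))\<rceil> \<and>
    (Digraph_Component.connected G \<and>
     \<not> digraph_iso G (with_proj (cycle_graph 5)) \<and>
     \<not> digraph_iso G (with_proj (cycle_graph 9)) \<longrightarrow>
     int (game_domination_number G) \<le> \<lfloor>11 / 20 * real (card (verts G))\<rfloor>)"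
proof -
  have c: "claw_free_nbhd (verts G) (nbhd G)" using claw_free_nbhdI[OF assms] .
  interpret claw_free_nbhd "verts G" "nbhd G" by (rule c)
  define t where "t = game_domination_number G"
  have bound: "20 * int t \<le> K" if "dom_bound (verts G) K" for K
    unfolding t_def game_domination_number_def by (rule remaining_moves_bound[OF c that]) simp
  \<comment> \<open>From 20 t <= 11 n + 5 < 11 n + 20 it follows that t exceeds 11 n / 20 by less
    than 1.\<close>
  have "int t \<le> \<lceil>11 / 20 * real (card (verts G))\<rceil>"
    using bound[OF dom_bound_V] by linarith
  moreover have "int t \<le> \<lfloor>11 / 20 * real (card (verts G))\<rfloor>"
    if con: "connected G" and ni: "\<not> digraph_iso G (with_proj (cycle_graph 5))"
      "\<not> digraph_iso G (with_proj (cycle_graph 9))"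
  proof -
    have "length xs \<noteq> 5" "length xs \<noteq> 9" if "closed_cycle xs" for xs
      using closed_cycle_iso[OF c assms(1) con that] ni by fastforce+
    then have "20 * int t \<le> 11 * int (card (verts G))" by (intro bound dom_bound_V_no_small_cycles)
    then show ?thesis by linarith
  qed
  ultimately show ?thesis unfolding t_def by blast
qed

end
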